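(* Let $e\colon C\to Y$ be an étale map into a geodesic $q$-manifold $Y$ with atlas $\mathcal V$. Then $C$ is a geodesic $q$-manifold with atlas $\mathcal V_e$.
   Context: **Convexity spaces.** For a Hausdorff space $X$, the power set $\mathfrak{P}(X)$ is given the topology with basis the sets $\widetilde U=\{A\subset X : A\subset U\}$, $U\subset X$ open. A convexity space is a Hausdorff space $X$ with a continuous map $C\colon X\times X\to\mathfrak{P}(X)$ such that, calling $A\subset X$ convex if $C(x,y)\subset A$ for all $x,y\in A$: (C1) every $C(x,y)$ is convex; (C2) $C(x,y)$ is minimal (with respect to inclusion) among the connected subsets of $X$ containing $x$ and $y$ (in particular it is such a set); (C3) $X$ has a basis of convex open sets. A convex subset of a convexity space is a convexity space by restriction. **Star-finiteness.** A star in a convexity space $X$ with center $x$ and end set $E\subset X\setminus\{x\}$ is a subspace $S(x,E)=\bigcup_{z\in E}C(x,z)$ such that $C(x,z)\cap C(x,z')=\{x\}$ for different $z,z'\in E$ and such that $S(x,E)$ carries the finest topology making all inclusions $C(x,z)\hookrightarrow S(x,E)$ ($z\in E$) continuous. $X$ is star-finite if every star that is closed in $X$ has a finite end set. **Local convexity structures.** A local convexity structure (atlas) on a topological space $Y$ is an open covering $\mathcal V$ of $Y$ by convexity spaces $V\in\mathcal V$ (with the induced topology) such that for every $V\in\mathcal V$, every convex open subspace of $V$ belongs to $\mathcal V$ (as a convexity space). A subset $A\subset Y$ is convex if $A\cap V$ is convex in $V$ for all $V\in\mathcal V$; $C(A)$ denotes the smallest convex subset containing $A$. **Étale maps.** Let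 $e\colon C\to Y$ be continuous with $C$ connected, $Y$ having local convexity structure $\mathcal V$. $\mathcal V_e$ denotes the set of all open $U\subset C$ mapped by $e$ homeomorphically onto a convex subspace of some $V\in\mathcal V$. $e$ is étale if $e$ is a closed map and $\mathcal V_e$ covers $C$. In this case $\mathcal V_e$ is regarded as a local convexity structure on $C$, each $U\in\mathcal V_e$ carrying the convexity structure transported along the homeomorphism $U\cong e(U)$ from the convex subspace $e(U)$ of $V$. $e$ is generated by a subset $F\subset C$ if there is no closed connected subspace $A\subsetneq C$ with $F\subset A$ such that $e(U\cap A)$ is convex for all $U\in\mathcal V_e$. **Geodesic manifolds.** A geodesic manifold is a Hausdorff space $Y$ with a local convexity structure $\mathcal V$ (its atlas) such that: (G1) for every finite $F\subset Y$, the closure of $C(F)$ is compact; (G2) if an étale map $e\colon C\to Y$ with $C$ compact is generated by $\{x,y\}\subset C$, then every connected $A\subset C$ with $x,y\in A$ equals $C$. It is a geodesic $q$-manifold if in addition every $V\in\mathcal V$ is star-finite and regular as a topological space.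
   Formalization: Étale maps (in the theorem and in (G2)) are required to have a Hausdorff domain C; without this the projection of the line with two origins onto the real line would be étale although its domain is not a geodesic manifold. *)

theory Defs
  imports "HOL-Analysis.Analysis"
begin

text \<open>Spaces are abstract topologies. A convexity map on a space with point set \<open>V\<close> is a function
  \<open>K\<close> on pairs that is \<^const>\<open>extensional\<close> on \<open>V \<times> V\<close>; thus a convexity space inside an
  ambient space is determined by the pair \<open>(V, K)\<close>, and its restriction to a convex \<open>U \<subseteq> V\<close> is
  \<open>(U, restrict K (U \<times> U))\<close>.\<close>

type_synonym 'a convexity_map = "'a \<times> 'a \<Rightarrow> 'a set"
type_synonym 'a atlas = "('a set \<times> 'a convexity_map) set"

text \<open>The generating family is closed under finite intersections, hence a basis; see
  \<open>openin_powerset_topology\<close> below.\<close>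

definition powerset_topology :: "'a topology \<Rightarrow> 'a set topology" where
  "powerset_topology X = topology_generated_by (Pow ` {U. openin X U})"

definition convex_subset :: "'a set \<Rightarrow> 'a convexity_map \<Rightarrow> 'a set \<Rightarrow> bool" where
  "convex_subset V K A \<longleftrightarrow> A \<subseteq> V \<and> (\<forall>x\<in>A. \<forall>y\<in>A. K (x, y) \<subseteq> A)"

definition convexity_space :: "'a topology \<Rightarrow> 'a convexity_map \<Rightarrow> bool" where
  "convexity_space X K \<longleftrightarrow>
     Hausdorff_space X \<and>
     K \<in> extensional (topspace X \<times> topspace X) \<and>
     continuous_map (prod_topology X X) (powerset_topology X) K \<and>
     (\<forall>x\<in>topspace X. \<forall>y\<in>topspace X. convex_subset (topspace X) K (K (x, y))) \<and>
     (\<forall>x\<in>topspace X. \<forall>y\<in>topspace X.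
        connectedin X (K (x, y)) \<and> x \<in> K (x, y) \<and> y \<in> K (x, y) \<and>
        (\<forall>B. connectedin X B \<and> x \<in> B \<and> y \<in> B \<and> B \<subseteq> K (x, y) \<longrightarrow> B = K (x, y))) \<and>
     (\<forall>U x. openin X U \<and> x \<in> U \<longrightarrow>
        (\<exists>W. openin X W \<and> convex_subset (topspace X) K W \<and> x \<in> W \<and> W \<subseteq> U))"

definition star_set :: "'a convexity_map \<Rightarrow> 'a \<Rightarrow> 'a set \<Rightarrow> 'a set" where
  "star_set K x E = (\<Union>z\<in>E. K (x, z))"

definition is_star :: "'a topology \<Rightarrow> 'a convexity_map \<Rightarrow> 'a \<Rightarrow> 'a set \<Rightarrow> bool" where
  "is_star X K x E \<longleftrightarrow>
     x \<in> topspace X \<and> E \<subseteq> topspace X - {x} \<and>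
     (\<forall>z\<in>E. \<forall>z'\<in>E. z \<noteq> z' \<longrightarrow> K (x, z) \<inter> K (x, z') = {x}) \<and>
     (\<forall>T. topspace T = star_set K x E \<and>
          (\<forall>z\<in>E. continuous_map (subtopology X (K (x, z))) T (\<lambda>p. p)) \<longrightarrow>
          (\<forall>W. openin T W \<longrightarrow> openin (subtopology X (star_set K x E)) W))"

definition star_finite :: "'a topology \<Rightarrow> 'a convexity_map \<Rightarrow> bool" where
  "star_finite X K \<longleftrightarrow>
     (\<forall>x E. is_star X K x E \<and> closedin X (star_set K x E) \<longrightarrow> finite E)"

definition local_convexity_structure :: "'a topology \<Rightarrow> 'a atlas \<Rightarrow> bool" where
  "local_convexity_structure Y \<V> \<longleftrightarrow>
     \<Union>(fst ` \<V>) = topspace Y \<and>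
     (\<forall>(V, K)\<in>\<V>. openin Y V \<and> convexity_space (subtopology Y V) K \<and>
        (\<forall>U. openin (subtopology Y V) U \<and> convex_subset V K U \<longrightarrow>
             (U, restrict K (U \<times> U)) \<in> \<V>))"

definition locally_convex_subset :: "'a topology \<Rightarrow> 'a atlas \<Rightarrow> 'a set \<Rightarrow> bool" where
  "locally_convex_subset Y \<V> A \<longleftrightarrow>
     A \<subseteq> topspace Y \<and> (\<forall>(V, K)\<in>\<V>. convex_subset V K (A \<inter> V))"

definition local_convex_hull :: "'a topology \<Rightarrow> 'a atlas \<Rightarrow> 'a set \<Rightarrow> 'a set" where
  "local_convex_hull Y \<V> A = locally_convex_subset Y \<V> hull A"

text \<open>The atlas \<open>\<V>\<^sub>e\<close> of a map \<open>e\<close> from \<open>C\<close> to \<open>Y\<close>. Note that \<open>e ` U\<close> is convex in \<open>V\<close> but need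
  not be open in \<open>V\<close>.\<close>

definition induced_atlas :: "'c topology \<Rightarrow> 'a topology \<Rightarrow> 'a atlas \<Rightarrow> ('c \<Rightarrow> 'a) \<Rightarrow> 'c atlas" where
  "induced_atlas C Y \<V> e =
     {(U, restrict (\<lambda>(x, y). {z\<in>U. e z \<in> K (e x, e y)}) (U \<times> U)) | U V K.
        openin C U \<and> (V, K) \<in> \<V> \<and> convex_subset V K (e ` U) \<and>
        homeomorphic_map (subtopology C U) (subtopology Y (e ` U)) e}"

text \<open>All spaces are understood to be Hausdorff, so this is required of the domain of an etale map.
  It does not follow from the other conditions: the projection of the line with two origins onto
  the real line is closed and satisfies all of them.\<close>

definition etale_map :: "'c topology \<Rightarrow> 'a topology \<Rightarrow> 'a atlas \<Rightarrow> ('c \<Rightarrow> 'a) \<Rightarrow> bool" where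
  "etale_map C Y \<V> e \<longleftrightarrow>
     Hausdorff_space C \<and> connected_space C \<and> continuous_map C Y e \<and> closed_map C Y e \<and>
     \<Union>(fst ` induced_atlas C Y \<V> e) = topspace C"

definition etale_generated_by ::
    "'c topology \<Rightarrow> 'a topology \<Rightarrow> 'a atlas \<Rightarrow> ('c \<Rightarrow> 'a) \<Rightarrow> 'c set \<Rightarrow> bool" where
  "etale_generated_by C Y \<V> e F \<longleftrightarrow>
     F \<subseteq> topspace C \<and>
     \<not> (\<exists>A. closedin C A \<and> connectedin C A \<and> A \<subset> topspace C \<and> F \<subseteq> A \<and>
           (\<forall>U\<in>fst ` induced_atlas C Y \<V> e. locally_convex_subset Y \<V> (e ` (U \<inter> A))))"

text \<open>The last clause quantifies over all compact etale spaces over \<open>Y\<close>. Such a space is a finite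
  union of sets on which the map is injective, so up to homeomorphism its points may be taken in
  \<^typ>\<open>'a \<times> nat\<close>; \<open>geodesic_manifold_etale_minimal\<close> below derives the clause for all types.\<close>

definition geodesic_manifold :: "'a topology \<Rightarrow> 'a atlas \<Rightarrow> bool" where
  "geodesic_manifold Y \<V> \<longleftrightarrow>
     Hausdorff_space Y \<and> local_convexity_structure Y \<V> \<and>
     (\<forall>F. finite F \<and> F \<subseteq> topspace Y \<longrightarrow> compactin Y (Y closure_of local_convex_hull Y \<V> F)) \<and>
     (\<forall>(C :: ('a \<times> nat) topology) e x y.
        etale_map C Y \<V> e \<and> compact_space C \<and> etale_generated_by C Y \<V> e {x, y} \<longrightarrow>
        (\<forall>A. connectedin C A \<and> x \<in> A \<and> y \<in> A \<longrightarrow> A = topspace C))"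

definition geodesic_q_manifold :: "'a topology \<Rightarrow> 'a atlas \<Rightarrow> bool" where
  "geodesic_q_manifold Y \<V> \<longleftrightarrow>
     geodesic_manifold Y \<V> \<and>
     (\<forall>(V, K)\<in>\<V>. star_finite (subtopology Y V) K \<and> regular_space (subtopology Y V))"

lemma openin_powerset_topology:
  "openin (powerset_topology X) \<W> \<longleftrightarrow> (\<forall>A\<in>\<W>. \<exists>U. openin X U \<and> A \<subseteq> U \<and> Pow U \<subseteq> \<W>)"
proof
  assume "openin (powerset_topology X) \<W>"
  then have "generate_topology_on (Pow ` {U. openin X U}) \<W>"
    by (simp add: powerset_topology_def openin_topology_generated_by_iff)
  then show "\<forall>A\<in>\<W>. \<exists>U. openin X U \<and> A \<subseteq> U \<and> Pow U \<subseteq> \<W>"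
  proof induction
    case Empty
    show ?case by blast
  next
    case (Int a b)
    show ?case
    proof
      fix A assume "A \<in> a \<inter> b"
      then obtain U U' where "openin X U" "A \<subseteq> U" "Pow U \<subseteq> a" "openin X U'" "A \<subseteq> U'" "Pow U' \<subseteq> b"
        using Int.IH by (meson IntD1 IntD2)
      then have "openin X (U \<inter> U')" "A \<subseteq> U \<inter> U'" "Pow (U \<inter> U') \<subseteq> a \<inter> b"
        by (simp_all add: openin_Int Pow_Int_eq le_infI1 le_infI2)
      then show "\<exists>U. openin X U \<and> A \<subseteq> U \<and> Pow U \<subseteq> a \<inter> b"
        by (intro exI[of _ "U \<inter> U'"] conjI)
    qed
  next
    case (UN \<K>)
    show ?case
    proof
      fix A assume "A \<in> \<Union>\<K>"
      then obtain k where k: "k \<in> \<K>" "A \<in> k" by (rule UnionE)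
      then obtain U where "openin X U" "A \<subseteq> U" "Pow U \<subseteq> k" using UN.IH by meson
      then show "\<exists>U. openin X U \<and> A \<subseteq> U \<and> Pow U \<subseteq> \<Union>\<K>"
        using Union_upper[OF k(1)] by (intro exI[of _ U] conjI) (assumption | rule order_trans)+
    qed
  next
    case (Basis s)
    then obtain U where "openin X U" "s = Pow U" by blast
    then show ?case by (metis PowD order_refl)
  qed
next
  assume *: "\<forall>A\<in>\<W>. \<exists>U. openin X U \<and> A \<subseteq> U \<and> Pow U \<subseteq> \<W>"
  show "openin (powerset_topology X) \<W>"
  proof (subst openin_subopen, intro ballI)
    fix A assume "A \<in> \<W>"
    then obtain U where U: "openin X U" "A \<subseteq> U" "Pow U \<subseteq> \<W>"
      using * by meson
    then have "openin (powerset_topology X) (Pow U)"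
      by (simp add: powerset_topology_def topology_generated_by_Basis)
    moreover have "A \<in> Pow U"
      using U(2) by simp
    ultimately show "\<exists>T. openin (powerset_topology X) T \<and> A \<in> T \<and> T \<subseteq> \<W>"
      using U(3) by (intro exI[of _ "Pow U"] conjI)
  qed
qed

lemma fst_induced_atlas:
  "fst ` induced_atlas C Y \<V> e =
     {U. openin C U \<and> (\<exists>V K. (V, K) \<in> \<V> \<and> convex_subset V K (e ` U)) \<and>
         homeomorphic_map (subtopology C U) (subtopology Y (e ` U)) e}" (is "?L = ?R")
proof (intro set_eqI iffI)
  fix U assume "U \<in> ?R"
  then obtain V K where "openin C U" "(V, K) \<in> \<V>" "convex_subset V K (e ` U)"
      "homeomorphic_map (subtopology C U) (subtopology Y (e ` U)) e"
    by blast
  then have "(U, restrict (\<lambda>(x, y). {z\<in>U. e z \<in> K (e x, e y)}) (U \<times> U)) \<in> induced_atlas C Y \<V> e"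
    unfolding induced_atlas_def mem_Collect_eq
    by (intro exI[of _ U] exI[of _ V] exI[of _ K] conjI) (rule refl | assumption)+
  then show "U \<in> ?L" by (rule image_eqI[rotated]) simp
next
  fix U assume "U \<in> ?L"
  then obtain k where "(U, k) \<in> induced_atlas C Y \<V> e" by auto
  then obtain V K where "openin C U" "(V, K) \<in> \<V>" "convex_subset V K (e ` U)"
      "homeomorphic_map (subtopology C U) (subtopology Y (e ` U)) e"
    unfolding induced_atlas_def mem_Collect_eq prod.inject by (elim exE conjE) simp
  then show "U \<in> ?R" by blast
qed

lemma fst_induced_atlas_compose:
  assumes g: "homeomorphic_map D C g" and U: "U \<in> fst ` induced_atlas C Y \<V> e"
    and W: "W \<subseteq> topspace D" "g ` W = U"
  shows "W \<in> fst ` induced_atlas D Y \<V> (e \<circ> g)"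
proof -
  have "openin D W"
    using homeomorphic_map_openness[OF g W(1)] U W(2) by (simp add: fst_induced_atlas)
  moreover have "homeomorphic_map (subtopology D W) (subtopology C U) g"
  proof (rule homeomorphic_map_subtopologies[OF g])
    have "U \<subseteq> topspace C" using U by (auto simp: fst_induced_atlas dest: openin_subset)
    then show "g ` (topspace D \<inter> W) = topspace C \<inter> U"
      using W by (simp add: Int_absorb1)
  qed
  moreover have "(e \<circ> g) ` W = e ` U"
    unfolding image_comp [symmetric] W(2) ..
  ultimately show ?thesis
    using U homeomorphic_map_compose[of "subtopology D W" "subtopology C U" g _ e]
    unfolding fst_induced_atlas mem_Collect_eq by metis
qed

lemma fst_induced_atlas_preimage:
  assumes g: "homeomorphic_map D C g" and U: "U \<in> fst ` induced_atlas C Y \<V> e"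
  shows "g ` {w \<in> topspace D. g w \<in> U} = U"
    and "{w \<in> topspace D. g w \<in> U} \<in> fst ` induced_atlas D Y \<V> (e \<circ> g)"
proof -
  have "U \<subseteq> g ` topspace D"
    using U homeomorphic_imp_surjective_map[OF g] openin_subset[of C U]
    by (simp add: fst_induced_atlas)
  then show *: "g ` {w \<in> topspace D. g w \<in> U} = U" by fast
  show "{w \<in> topspace D. g w \<in> U} \<in> fst ` induced_atlas D Y \<V> (e \<circ> g)"
    by (rule fst_induced_atlas_compose[OF g U _ *]) fast
qed

lemma etale_map_compose:
  assumes g: "homeomorphic_map D C g" and e: "etale_map C Y \<V> e"
  shows "etale_map D Y \<V> (e \<circ> g)"
proof -
  have h: "D homeomorphic_space C"
    using g homeomorphic_map_imp_homeomorphic_space by blast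
  have "topspace D \<subseteq> \<Union>(fst ` induced_atlas D Y \<V> (e \<circ> g))"
  proof
    fix d assume d: "d \<in> topspace D"
    then have "g d \<in> topspace C" using homeomorphic_imp_surjective_map[OF g] by blast
    then obtain U where U: "U \<in> fst ` induced_atlas C Y \<V> e" "g d \<in> U"
      using e unfolding etale_map_def by blast
    have "d \<in> {w \<in> topspace D. g w \<in> U}" using d U(2) by simp
    then show "d \<in> \<Union>(fst ` induced_atlas D Y \<V> (e \<circ> g))"
      using fst_induced_atlas_preimage(2)[OF g U(1)] by (rule UnionI[rotated])
  qed
  moreover have "\<Union>(fst ` induced_atlas D Y \<V> (e \<circ> g)) \<subseteq> topspace D"
    by (auto simp: fst_induced_atlas dest: openin_subset)
  ultimately show ?thesis
    using e homeomorphic_Hausdorff_space[OF h] homeomorphic_connected_space[OF h]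
      closed_map_compose[OF homeomorphic_imp_closed_map[OF g], of Y e]
      continuous_map_compose[OF homeomorphic_imp_continuous_map[OF g], of Y e]
    unfolding etale_map_def by (intro conjI subset_antisym) simp_all
qed

lemma etale_generated_by_compose:
  assumes g: "homeomorphic_map D C g" and xy: "x \<in> topspace D" "y \<in> topspace D"
    and gen: "etale_generated_by C Y \<V> e {g x, g y}"
  shows "etale_generated_by D Y \<V> (e \<circ> g) {x, y}"
proof -
  have inj: "inj_on g (topspace D)" and sur: "g ` topspace D = topspace C"
    using g homeomorphic_imp_injective_map homeomorphic_imp_surjective_map by blast+
  have False
    if A: "closedin D A" "connectedin D A" "A \<subset> topspace D" "{x, y} \<subseteq> A"
      and conv: "\<forall>W\<in>fst ` induced_atlas D Y \<V> (e \<circ> g).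
                   locally_convex_subset Y \<V> ((e \<circ> g) ` (W \<inter> A))" for A
  proof -
    have As: "A \<subseteq> topspace D" using A by blast
    have "locally_convex_subset Y \<V> (e ` (U \<inter> g ` A))"
      if U: "U \<in> fst ` induced_atlas C Y \<V> e" for U
    proof -
      let ?W = "{w \<in> topspace D. g w \<in> U}"
      have "(e \<circ> g) ` (?W \<inter> A) = e ` (U \<inter> g ` A)"
        using As by auto
      then show ?thesis
        using conv fst_induced_atlas_preimage(2)[OF g U] by metis
    qed
    moreover have "closedin C (g ` A)" "connectedin C (g ` A)"
      using A As homeomorphic_map_closedness[OF g As] homeomorphic_map_connectedness[OF g As] by auto
    moreover have "g ` A \<subset> topspace C"
      using A(3) inj sur by (metis image_strict_mono)
    moreover have "{g x, g y} \<subseteq> g ` A" using A(4) by simp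
    ultimately show False using gen unfolding etale_generated_by_def by metis
  qed
  moreover have "{x, y} \<subseteq> topspace D" using xy by simp
  ultimately show ?thesis unfolding etale_generated_by_def by metis
qed

lemma geodesic_manifold_etale_minimal:
  fixes C :: "'c topology" and Y :: "'a topology"
  assumes Y: "geodesic_manifold Y \<V>" and e: "etale_map C Y \<V> e" and C: "compact_space C"
    and gen: "etale_generated_by C Y \<V> e {x, y}" and A: "connectedin C A" "x \<in> A" "y \<in> A"
  shows "A = topspace C"
proof -
  let ?\<U> = "fst ` induced_atlas C Y \<V> e"
  have op: "\<forall>U\<in>?\<U>. openin C U" and cov: "\<Union>?\<U> = topspace C"
    using e by (auto simp: fst_induced_atlas etale_map_def)
  obtain \<F> where \<F>: "finite \<F>" "\<F> \<subseteq> ?\<U>" "topspace C \<subseteq> \<Union>\<F>"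
  proof -
    have "(\<forall>U\<in>?\<U>. openin C U) \<and> topspace C \<subseteq> \<Union>?\<U>" using op cov by simp
    then show ?thesis using C that unfolding compact_space_alt by meson
  qed
  obtain n :: "'c set \<Rightarrow> nat" where n: "inj_on n \<F>"
    using \<F>(1) finite_imp_inj_to_nat_seg by meson
  have "\<forall>c\<in>topspace C. \<exists>U. U \<in> \<F> \<and> c \<in> U" using \<F>(3) by blast
  then obtain u where u: "\<And>c. c \<in> topspace C \<Longrightarrow> u c \<in> \<F> \<and> c \<in> u c" by metis
  define h where "h c = (e c, n (u c))" for c
  have inj: "inj_on h (topspace C)"
  proof (rule inj_onI)
    fix c d assume cd: "c \<in> topspace C" "d \<in> topspace C" "h c = h d"
    then have "u c = u d" using n u by (simp add: h_def inj_on_def)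
    moreover have "inj_on e (u c)"
    proof -
      have "openin C (u c)" "homeomorphic_map (subtopology C (u c)) (subtopology Y (e ` u c)) e"
        using u[OF cd(1)] \<F>(2) by (auto simp: fst_induced_atlas)
      then show ?thesis
        by (metis homeomorphic_imp_injective_map openin_subset topspace_subtopology_subset)
    qed
    ultimately show "c = d" using u cd by (auto simp: h_def inj_on_def)
  qed
  define g where "g = inv_into (topspace C) h"
  define D where "D = pullback_topology (h ` topspace C) g C"
  have gh: "g (h c) = c" if "c \<in> topspace C" for c
    using inj that by (simp add: g_def)
  have tD: "topspace D = h ` topspace C"
    using gh by (auto simp: D_def topspace_pullback_topology)
  have "homeomorphic_maps D C g h"
    unfolding homeomorphic_maps_def
  proof (intro conjI ballI)
    show "continuous_map D C g"
      using continuous_map_pullback[OF continuous_map_id] by (simp add: D_def)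
    show "continuous_map C D h"
      unfolding D_def
    proof (rule continuous_map_pullback')
      show "continuous_map C C (g \<circ> h)"
        by (rule continuous_map_eq[OF continuous_map_id]) (simp add: gh)
      show "topspace C \<subseteq> h -` h ` topspace C"
        by (simp add: image_subset_iff_subset_vimage[symmetric])
    qed
  qed (auto simp: tD gh)
  then have g: "homeomorphic_map D C g" using homeomorphic_map_maps by blast
  have xy: "x \<in> topspace C" "y \<in> topspace C"
    using A connectedin_subset_topspace by blast+
  have sub: "A \<subseteq> topspace C" using A(1) connectedin_subset_topspace by blast
  have "etale_map D Y \<V> (e \<circ> g)" using etale_map_compose[OF g e] .
  moreover have "compact_space D"
    using C g homeomorphic_compact_space homeomorphic_map_imp_homeomorphic_space by blast
  moreover have "etale_generated_by D Y \<V> (e \<circ> g) {h x, h y}"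
    using xy gen by (intro etale_generated_by_compose[OF g]) (auto simp: tD gh)
  moreover have "connectedin D (h ` A)"
  proof -
    have "g ` h ` A = A"
      unfolding image_image using gh sub by (simp add: subset_iff)
    moreover have "h ` A \<subseteq> topspace D"
      unfolding tD using sub by (rule image_mono)
    ultimately show ?thesis
      using homeomorphic_map_connectedness[OF g, of "h ` A"] A(1) by simp
  qed
  ultimately have "h ` A = topspace D"
    using Y imageI[OF A(2), of h] imageI[OF A(3), of h] unfolding geodesic_manifold_def by meson
  then show ?thesis
    using inj sub by (metis inj_on_image_eq_iff order_refl tD)
qed

end

theory Submission
  imports Defs "HOL-Library.Ramsey"
begin

text \<open>In a convexity space every segment \<open>K (a, b)\<close> is compact and linearly ordered, with the
  segments \<open>K (a, r)\<close> as initial intervals. Applying (G2) to inclusions of segments shows that any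
  two charts of a geodesic manifold have the same segments on their intersection. Hence sheets around
  the points of a fibre of \<open>e\<close> can be chosen with images convex in one chart, and unique lifting of
  segments makes them disjoint. Since \<open>e\<close> is closed, a family of relatively closed subsets of their
  images then has a closed union near the base point. This yields finite fibres: an infinite one would
  produce either an infinite closed star or a sequence in a compact segment without accumulation
  point. So \<open>e\<close> is proper, which gives (G1). (G2) holds because etale maps compose and generation
  carries over to the composite, and star-finiteness because a closed star in a sheet can be shrunk to
  a closed star in a chart of \<open>Y\<close>.\<close>

section \<open>Segments of convexity spaces\<close>

text \<open>The image of a sheet need be neither open nor closed in a chart; the inclusion of a
  segment is already etale. So \<open>e\<close> need not be a covering map, and the substitute for
  even covering is a statement about closed sets. Moreover, an atlas demands nothing of two
  overlapping charts, and each sheet comes with a chart of its own. For a fibre that may be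
  infinite, a common chart cannot be reached by intersecting neighbourhoods of the base point; the
  agreement of segments in all charts is what makes one chart serve the whole fibre. Star-finiteness
  in turn speaks only of segments with a single common point, whereas the images of disjoint sheets
  may overlap in \<open>Y\<close>. Ramsey's theorem separates the case in which the segments form a
  star from the case in which they overlap.\<close>

lemma convex_subsetD:
  assumes "convex_subset V K A"
  shows "A \<subseteq> V" "a \<in> A \<Longrightarrow> b \<in> A \<Longrightarrow> K (a, b) \<subseteq> A"
  using assms by (simp_all add: convex_subset_def)

lemma topspace_powerset_topology: "topspace (powerset_topology X) = Pow (topspace X)"
proof (rule subset_antisym)
  show "Pow (topspace X) \<subseteq> topspace (powerset_topology X)"
    by (rule openin_subset) (auto simp: openin_powerset_topology)
  show "topspace (powerset_topology X) \<subseteq> Pow (topspace X)"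
    using openin_topspace[of "powerset_topology X"] openin_subset
    unfolding openin_powerset_topology by blast
qed

text \<open>The sets \<open>Pow U\<close> form a basis, so continuity is upper semicontinuity of a
  set-valued map. Continuity is used in this form throughout.\<close>

lemma continuous_map_powerset_topology:
  "continuous_map (prod_topology X X) (powerset_topology X) K \<longleftrightarrow>
     (\<forall>a\<in>topspace X. \<forall>b\<in>topspace X. K (a, b) \<subseteq> topspace X) \<and>
     (\<forall>a\<in>topspace X. \<forall>b\<in>topspace X. \<forall>U. openin X U \<and> K (a, b) \<subseteq> U \<longrightarrow>
        (\<exists>M N. openin X M \<and> openin X N \<and> a \<in> M \<and> b \<in> N \<and> (\<forall>a'\<in>M. \<forall>b'\<in>N. K (a', b') \<subseteq> U)))"
  (is "?L \<longleftrightarrow> ?P \<and> ?Q")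
proof
  assume L: ?L
  then have ?P
    by (auto simp: continuous_map_def topspace_powerset_topology Pi_iff)
  moreover have ?Q
  proof (intro ballI allI impI, elim conjE)
    fix a b U assume ab: "a \<in> topspace X" "b \<in> topspace X" and U: "openin X U" "K (a, b) \<subseteq> U"
    have "openin (powerset_topology X) (Pow U)"
      using U(1) by (auto simp: openin_powerset_topology)
    then have "openin (prod_topology X X) {p \<in> topspace (prod_topology X X). K p \<in> Pow U}"
      using L openin_continuous_map_preimage by blast
    moreover have "(a, b) \<in> {p \<in> topspace (prod_topology X X). K p \<in> Pow U}"
      using ab U(2) by simp
    ultimately have "\<exists>M N. openin X M \<and> openin X N \<and> a \<in> M \<and> b \<in> N \<and>
        M \<times> N \<subseteq> {p \<in> topspace (prod_topology X X). K p \<in> Pow U}"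
      unfolding openin_prod_topology_alt by simp
    then obtain M N where MN: "openin X M" "openin X N" "a \<in> M" "b \<in> N"
        "M \<times> N \<subseteq> {p \<in> topspace (prod_topology X X). K p \<in> Pow U}"
      by blast
    have "K (a', b') \<subseteq> U" if "a' \<in> M" "b' \<in> N" for a' b'
      using subsetD[OF MN(5), of "(a', b')"] that by simp
    then show "\<exists>M N. openin X M \<and> openin X N \<and> a \<in> M \<and> b \<in> N \<and>
        (\<forall>a'\<in>M. \<forall>b'\<in>N. K (a', b') \<subseteq> U)"
      using MN(1-4) by metis
  qed
  ultimately show "?P \<and> ?Q" by simp
next
  assume PQ: "?P \<and> ?Q"
  have "openin (prod_topology X X) {p \<in> topspace (prod_topology X X). K p \<in> \<W>}"
    if \<W>: "openin (powerset_topology X) \<W>" for \<W>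
    unfolding openin_prod_topology_alt
  proof (intro allI impI)
    fix a b assume "(a, b) \<in> {p \<in> topspace (prod_topology X X). K p \<in> \<W>}"
    then have ab: "a \<in> topspace X" "b \<in> topspace X" "K (a, b) \<in> \<W>" by simp_all
    then obtain U where U: "openin X U" "K (a, b) \<subseteq> U" "Pow U \<subseteq> \<W>"
      using \<W> by (auto simp: openin_powerset_topology)
    have "\<exists>M N. openin X M \<and> openin X N \<and> a \<in> M \<and> b \<in> N \<and> (\<forall>a'\<in>M. \<forall>b'\<in>N. K (a', b') \<subseteq> U)"
      using PQ ab(1,2) U(1,2) by simp
    then obtain M N where MN: "openin X M" "openin X N" "a \<in> M" "b \<in> N"
        "\<forall>a'\<in>M. \<forall>b'\<in>N. K (a', b') \<subseteq> U"
      by blast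
    have "K (a', b') \<in> \<W>" if "a' \<in> M" "b' \<in> N" for a' b'
      using MN(5) U(3) that by blast
    then have "M \<times> N \<subseteq> {p \<in> topspace (prod_topology X X). K p \<in> \<W>}"
      using openin_subset[OF MN(1)] openin_subset[OF MN(2)] by auto
    then show "\<exists>M N. openin X M \<and> openin X N \<and> a \<in> M \<and> b \<in> N \<and>
        M \<times> N \<subseteq> {p \<in> topspace (prod_topology X X). K p \<in> \<W>}"
      using MN(1-4) by (intro exI[of _ M] exI[of _ N] conjI)
  qed
  then show ?L
    using PQ by (auto simp: continuous_map_def topspace_powerset_topology)
qed

text \<open>If removing \<open>r\<close> splits a connected set, each side together with
  \<open>r\<close> stays connected: a separation of one side extends to the whole set by adding the
  other side to the part that contains \<open>r\<close>.\<close>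

lemma connectedin_insert_Int_cut:
  assumes L: "connectedin X L" "r \<in> L"
    and AB: "openin X A" "openin X B" "L - {r} \<subseteq> A \<union> B" "A \<inter> B \<inter> L = {}" "r \<notin> A" "r \<notin> B"
  shows "connectedin X (insert r (L \<inter> A))"
proof -
  have False
    if E: "openin X E1" "openin X E2" "insert r (L \<inter> A) \<subseteq> E1 \<union> E2"
      "E1 \<inter> E2 \<inter> insert r (L \<inter> A) = {}" "E2 \<inter> insert r (L \<inter> A) \<noteq> {}" "r \<in> E1" for E1 E2
  proof -
    have "L \<subseteq> (E1 \<union> B) \<union> (E2 \<inter> A)" using E(3,6) AB(3) by blast
    moreover have "(E1 \<union> B) \<inter> (E2 \<inter> A) \<inter> L = {}" using E(4) AB(4) by blast
    moreover have "(E1 \<union> B) \<inter> L \<noteq> {}" using E(6) L(2) by blast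
    moreover have "(E2 \<inter> A) \<inter> L \<noteq> {}" using E(4-6) by blast
    ultimately show False
      using L(1) E(1,2) AB(1,2) unfolding connectedin by (meson openin_Int openin_Un)
  qed
  moreover have "insert r (L \<inter> A) \<subseteq> topspace X"
    using L connectedin_subset_topspace by blast
  ultimately show ?thesis
    unfolding connectedin by (metis Un_commute Int_commute UnE insert_subset)
qed

section \<open>The linear order on a segment\<close>

context
  fixes X :: "'a topology" and K :: "'a convexity_map"
  assumes cs: "convexity_space X K"
begin

lemma convexity_space_Hausdorff: "Hausdorff_space X"
  using cs by (simp add: convexity_space_def)

lemma segment_basic:
  assumes "a \<in> topspace X" "b \<in> topspace X"
  shows "connectedin X (K (a, b))" "a \<in> K (a, b)" "b \<in> K (a, b)" "K (a, b) \<subseteq> topspace X"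
  using cs assms connectedin_subset_topspace[of X "K (a, b)"] by (auto simp: convexity_space_def)

lemma segment_minimal:
  assumes "a \<in> topspace X" "b \<in> topspace X" "connectedin X B" "a \<in> B" "b \<in> B" "B \<subseteq> K (a, b)"
  shows "B = K (a, b)"
  using cs assms by (auto simp: convexity_space_def)

lemma segment_mono:
  assumes "a \<in> topspace X" "b \<in> topspace X" "c \<in> K (a, b)" "d \<in> K (a, b)"
  shows "K (c, d) \<subseteq> K (a, b)"
  using cs assms by (auto simp: convexity_space_def convex_subset_def)

lemma segment_sym:
  assumes "a \<in> topspace X" "b \<in> topspace X"
  shows "K (a, b) = K (b, a)"
  using assms segment_minimal[of a b "K (b, a)"] segment_basic segment_mono by metis

lemma segment_refl: "a \<in> topspace X \<Longrightarrow> K (a, a) = {a}"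
  using segment_minimal[of a a "{a}"] segment_basic[of a a] by (simp add: connectedin_sing)

text \<open>Minimality makes \<open>r\<close> a cut point. If \<open>a\<close> and \<open>b\<close>
  were on the same side, this side with \<open>r\<close> would be a smaller connected set containing
  both. The subsegments stay on their sides by the same argument, applied to \<open>K (a, r)\<close>
  and \<open>K (b, r)\<close>.\<close>

lemma segment_cut:
  assumes ab: "a \<in> topspace X" "b \<in> topspace X" and r: "r \<in> K (a, b)" "r \<noteq> a" "r \<noteq> b"
  obtains A B where "openin X A" "openin X B" "K (a, b) - {r} \<subseteq> A \<union> B" "A \<inter> B \<inter> K (a, b) = {}"
    "K (a, r) - {r} \<subseteq> A" "K (r, b) - {r} \<subseteq> B"
proof -
  note cut = that
  let ?J = "K (a, b)"
  have rX: "r \<in> topspace X" using segment_basic(4)[OF ab] r(1) by blast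
  have left: "K (p, r) - {r} \<subseteq> A"
    if AB: "openin X A" "openin X B" "?J - {r} \<subseteq> A \<union> B" "A \<inter> B \<inter> ?J = {}" "r \<notin> A" "r \<notin> B"
      and p: "p \<in> ?J" "p \<in> A" for p A B
  proof -
    have pX: "p \<in> topspace X" using segment_basic(4)[OF ab] p(1) by blast
    have sub: "K (p, r) \<subseteq> ?J" using segment_mono[OF ab p(1) r(1)] .
    have "connectedin X (insert r (K (p, r) \<inter> A))"
      by (rule connectedin_insert_Int_cut[of _ _ _ _ B]) (use segment_basic[OF pX rX] AB sub in auto)
    then have "insert r (K (p, r) \<inter> A) = K (p, r)"
      using p(2) segment_basic[OF pX rX] by (intro segment_minimal[OF pX rX]) auto
    then show ?thesis by blast
  qed
  have both: "\<not> (a \<in> A \<and> b \<in> A)"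
    if AB: "openin X A" "openin X B" "?J - {r} \<subseteq> A \<union> B" "A \<inter> B \<inter> ?J = {}" "r \<notin> A" "r \<notin> B"
      "B \<inter> ?J \<noteq> {}" for A B
  proof
    assume *: "a \<in> A \<and> b \<in> A"
    have "connectedin X (insert r (?J \<inter> A))"
      by (rule connectedin_insert_Int_cut[of _ _ _ _ B]) (use segment_basic[OF ab] AB r in auto)
    then have "insert r (?J \<inter> A) = ?J"
      using * r segment_basic[OF ab] by (intro segment_minimal[OF ab]) auto
    then have "?J \<subseteq> insert r A" by blast
    then show False using AB(4,6,7) by blast
  qed
  have "\<not> connectedin X (?J - {r})"
    using segment_minimal[OF ab, of "?J - {r}"] segment_basic[OF ab] r by blast
  then obtain E1 E2 where E: "openin X E1" "openin X E2" "?J - {r} \<subseteq> E1 \<union> E2"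
      "E1 \<inter> E2 \<inter> (?J - {r}) = {}" "E1 \<inter> (?J - {r}) \<noteq> {}" "E2 \<inter> (?J - {r}) \<noteq> {}"
    using segment_basic(4)[OF ab] unfolding connectedin by blast
  \<comment> \<open>The separating sets may contain \<open>r\<close>; deleting it (points are
    closed) makes them disjoint on the whole segment, as the cut lemma requires.\<close>
  define F where "F E = E - {r}" for E
  have F: "openin X (F E1)" "openin X (F E2)" "?J - {r} \<subseteq> F E1 \<union> F E2" "F E1 \<inter> F E2 \<inter> ?J = {}"
      "r \<notin> F E1" "r \<notin> F E2" "F E1 \<inter> ?J \<noteq> {}" "F E2 \<inter> ?J \<noteq> {}"
    using E convexity_space_Hausdorff rX unfolding F_def
    by (auto intro!: openin_diff closedin_Hausdorff_singleton)
  have aJ: "a \<in> ?J - {r}" "b \<in> ?J - {r}" using segment_basic[OF ab] r by auto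
  have main: thesis
    if AB: "openin X A" "openin X B" "?J - {r} \<subseteq> A \<union> B" "A \<inter> B \<inter> ?J = {}" "r \<notin> A" "r \<notin> B"
      and p: "a \<in> A" "b \<in> B" for A B
  proof (rule cut[OF AB(1-4)])
    show "K (a, r) - {r} \<subseteq> A" using left[OF AB] p aJ by blast
    have "K (b, r) - {r} \<subseteq> B" using left[of B A b] AB p aJ by blast
    then show "K (r, b) - {r} \<subseteq> B" using segment_sym[OF rX ab(2)] by simp
  qed
  have "(a \<in> F E1 \<and> b \<in> F E2) \<or> (a \<in> F E2 \<and> b \<in> F E1)"
    using both[of "F E1" "F E2"] both[of "F E2" "F E1"] F aJ by blast
  then show thesis
    using main[of "F E1" "F E2"] main[of "F E2" "F E1"] F by blast
qed

lemma segment_Un: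
  assumes ab: "a \<in> topspace X" "b \<in> topspace X" and r: "r \<in> K (a, b)"
  shows "K (a, b) = K (a, r) \<union> K (r, b)"
proof -
  have rX: "r \<in> topspace X" using segment_basic(4)[OF ab] r by blast
  have "connectedin X (K (a, r) \<union> K (r, b))"
    using segment_basic[OF ab(1) rX] segment_basic[OF rX ab(2)] by (intro connectedin_Un) auto
  then show ?thesis
    using segment_minimal[OF ab, of "K (a, r) \<union> K (r, b)"] segment_basic[OF ab] segment_mono[OF ab] r
      segment_basic[OF ab(1) rX] segment_basic[OF rX ab(2)]
    by (metis Un_iff Un_subset_iff)
qed

text \<open>Apart from \<open>r\<close>, the two subsegments lie on opposite sides of the cut at
  \<open>r\<close>.\<close>

lemma segment_Int:
  assumes ab: "a \<in> topspace X" "b \<in> topspace X" and r: "r \<in> K (a, b)"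
  shows "K (a, r) \<inter> K (r, b) = {r}"
proof (cases "r = a \<or> r = b")
  case True
  then show ?thesis using segment_refl ab segment_basic[OF ab] by auto
next
  case False
  have rX: "r \<in> topspace X" using segment_basic(4)[OF ab] r by blast
  obtain A B where *: "A \<inter> B \<inter> K (a, b) = {}" "K (a, r) - {r} \<subseteq> A" "K (r, b) - {r} \<subseteq> B"
    using segment_cut[OF ab r] False by metis
  then show ?thesis
    using segment_basic[OF ab(1) rX] segment_basic[OF rX ab(2)] segment_mono[OF ab] r
      segment_basic[OF ab] by blast
qed

text \<open>Antisymmetry of the order of points by their position towards the fixed end point
  \<open>b\<close>: the point \<open>a\<close> lies in both subsegments at \<open>r\<close>, which
  meet in \<open>r\<close> only.\<close>

lemma segment_antisym:
  assumes ab: "a \<in> topspace X" "b \<in> topspace X" and "r \<in> K (a, b)" "a \<in> K (r, b)"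
  shows "r = a"
proof -
  have "a \<in> K (a, r)" using segment_basic(2) ab(1) segment_basic(4)[OF ab] assms(3) by blast
  then have "a \<in> {r}" using segment_Int[OF ab assms(3)] assms(4) by blast
  then show ?thesis by simp
qed

text \<open>Splitting \<open>K (a, b)\<close> at \<open>t\<close> leaves only
  \<open>r \<in> K (t, b)\<close> as an alternative, and antisymmetry then gives
  \<open>r = t\<close>.\<close>

lemma segment_through:
  assumes ab: "a \<in> topspace X" "b \<in> topspace X" and r: "r \<in> K (a, b)" and t: "t \<in> K (r, b)"
  shows "r \<in> K (a, t)"
proof -
  have rX: "r \<in> topspace X" using segment_basic(4)[OF ab] r by blast
  have tX: "t \<in> topspace X" using segment_basic(4)[OF rX ab(2)] t by blast
  have "t \<in> K (a, b)" using segment_mono[OF ab r] segment_basic[OF ab] t by blast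
  then have "r \<in> K (a, t) \<or> r \<in> K (t, b)" using segment_Un[OF ab] r by blast
  then show ?thesis
    using segment_antisym[OF rX ab(2) t] segment_basic(3)[OF ab(1) tX] by blast
qed

lemma segment_linear:
  assumes ab: "a \<in> topspace X" "b \<in> topspace X" and "r \<in> K (a, b)" "t \<in> K (a, b)"
  shows "t \<in> K (a, r) \<or> r \<in> K (a, t)"
  using segment_Un[OF ab assms(3)] segment_through[OF ab assms(3)] assms(4) by blast

text \<open>Connected subsets of a segment are intervals: a missing point \<open>r\<close> between
  \<open>a\<close> and \<open>b\<close> would be a cut point with \<open>a\<close> and
  \<open>b\<close> on different sides, and the cut would disconnect \<open>B\<close>.\<close>

lemma segment_sub_connected:
  assumes pq: "p \<in> topspace X" "q \<in> topspace X"
    and B: "connectedin X B" "B \<subseteq> K (p, q)" "a \<in> B" "b \<in> B"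
  shows "K (a, b) \<subseteq> B"
proof -
  \<comment> \<open>Here \<open>a\<close> precedes \<open>b\<close> in the order starting at
    \<open>p\<close>; linearity and symmetry reduce the general case to this one.\<close>
  have *: "K (a, b) \<subseteq> B" if a: "a \<in> K (p, b)" and abB: "a \<in> B" "b \<in> B" for a b
  proof (rule ccontr)
    assume "\<not> K (a, b) \<subseteq> B"
    then obtain r where r: "r \<in> K (a, b)" "r \<notin> B" by blast
    have bJ: "a \<in> K (p, q)" "b \<in> K (p, q)" using B(2) abB by auto
    have X: "a \<in> topspace X" "b \<in> topspace X" using bJ segment_basic(4)[OF pq] by auto
    have rb: "r \<in> K (p, b)" using segment_mono[OF pq(1) X(2) a] r(1) segment_basic[OF pq(1) X(2)] by blast
    have rJ: "r \<in> K (p, q)" using segment_mono[OF pq bJ] r(1) by blast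
    have rX: "r \<in> topspace X" using rJ segment_basic(4)[OF pq] by auto
    have ne: "r \<noteq> a" "r \<noteq> b" using r abB by auto
    have "r \<noteq> p" using segment_antisym[of p b a] a r(1) pq X ne by blast
    moreover have "r \<noteq> q"
      using segment_antisym[of q p b] bJ(2) rb segment_sym pq X rX ne by metis
    ultimately obtain A D where AD: "openin X A" "openin X D" "K (p, q) - {r} \<subseteq> A \<union> D"
        "A \<inter> D \<inter> K (p, q) = {}" "K (p, r) - {r} \<subseteq> A" "K (r, q) - {r} \<subseteq> D"
      using segment_cut[OF pq rJ] by metis
    have "a \<in> A"
      using segment_through[OF pq(1) X(2) a r(1)] AD(5) ne by blast
    moreover have "b \<in> D"
    proof -
      have "b \<notin> K (p, r)"
        using segment_antisym[of b p r] rb segment_sym pq X rX ne by metis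
      then show ?thesis using segment_Un[OF pq rJ] bJ AD(6) ne by blast
    qed
    moreover have "B \<subseteq> A \<union> D" "A \<inter> D \<inter> B = {}" using AD(3,4) B(2) r(2) by blast+
    ultimately show False using B(1) AD(1,2) abB unfolding connectedin by blast
  qed
  have X: "a \<in> topspace X" "b \<in> topspace X" using B segment_basic(4)[OF pq] by auto
  show ?thesis
    using segment_linear[OF pq, of a b] *[of a b] *[of b a] B segment_sym[OF X] by blast
qed

text \<open>Continuity of \<open>K\<close> at the diagonal point \<open>(s, s)\<close>, where the
  segment shrinks to \<open>{s}\<close>.\<close>

lemma segment_small:
  assumes "openin X U" "s \<in> U"
  obtains N where "openin X N" "s \<in> N" "\<forall>a\<in>N. \<forall>b\<in>N. K (a, b) \<subseteq> U"
proof -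
  have sX: "s \<in> topspace X" using assms openin_subset by blast
  have "\<exists>M N. openin X M \<and> openin X N \<and> s \<in> M \<and> s \<in> N \<and> (\<forall>a'\<in>M. \<forall>b'\<in>N. K (a', b') \<subseteq> U)"
    using cs assms sX segment_refl[OF sX]
    unfolding convexity_space_def continuous_map_powerset_topology by (metis empty_subsetI insert_subset)
  then obtain M N where "openin X M" "openin X N" "s \<in> M" "s \<in> N" "\<forall>a'\<in>M. \<forall>b'\<in>N. K (a', b') \<subseteq> U"
    by blast
  then show thesis by (intro that[of "M \<inter> N"]) auto
qed

text \<open>For an open cover of the segment, the points \<open>s\<close> for which \<open>K (a, s)\<close> is finitely covered form
  a relatively clopen subset.\<close>

lemma compactin_segment:
  assumes ab: "a \<in> topspace X" "b \<in> topspace X"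
  shows "compactin X (K (a, b))"
  unfolding compactin_def
proof (intro conjI allI impI)
  let ?J = "K (a, b)"
  show "?J \<subseteq> topspace X" using segment_basic(4)[OF ab] .
  fix \<U> assume "(\<forall>U\<in>\<U>. openin X U) \<and> ?J \<subseteq> \<Union>\<U>"
  then have op: "\<forall>U\<in>\<U>. openin X U" and cov: "?J \<subseteq> \<Union>\<U>" by blast+
  define T where "T = {s \<in> ?J. \<exists>\<F>. finite \<F> \<and> \<F> \<subseteq> \<U> \<and> K (a, s) \<subseteq> \<Union>\<F>}"
  \<comment> \<open>Near \<open>s\<close> all short segments lie in one member \<open>U\<close> of
    the cover. Since \<open>K (a, t')\<close> is contained in
    \<open>K (a, t) \<union> K (t, t')\<close>, a finite cover for \<open>t\<close> needs at most
    \<open>U\<close> in addition to serve for \<open>t'\<close>.\<close>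
  have "\<exists>N. openin X N \<and> s \<in> N \<and> (\<forall>t\<in>N \<inter> ?J. \<forall>t'\<in>N \<inter> ?J. t \<in> T \<longrightarrow> t' \<in> T)" if s: "s \<in> ?J" for s
  proof -
    obtain U where U: "U \<in> \<U>" "s \<in> U" using s cov by blast
    then obtain N where N: "openin X N" "s \<in> N" "\<forall>a\<in>N. \<forall>b\<in>N. K (a, b) \<subseteq> U"
      using segment_small[of U s] op by blast
    have "t' \<in> T" if t: "t \<in> N \<inter> ?J" "t' \<in> N \<inter> ?J" "t \<in> T" for t t'
    proof -
      obtain \<F> where \<F>: "finite \<F>" "\<F> \<subseteq> \<U>" "K (a, t) \<subseteq> \<Union>\<F>" using t(3) by (auto simp: T_def)
      have X: "t \<in> topspace X" "t' \<in> topspace X" using t segment_basic(4)[OF ab] by auto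
      have "connectedin X (K (a, t) \<union> K (t, t'))"
        using segment_basic[OF ab(1) X(1)] segment_basic[OF X] by (intro connectedin_Un) auto
      moreover have "K (a, t) \<union> K (t, t') \<subseteq> ?J"
        using segment_mono[OF ab] segment_basic[OF ab] t by blast
      ultimately have "K (a, t') \<subseteq> K (a, t) \<union> K (t, t')"
        using segment_basic[OF ab(1) X(1)] segment_basic[OF X] by (intro segment_sub_connected[OF ab]) auto
      also have "\<dots> \<subseteq> \<Union>(insert U \<F>)" using \<F>(3) N(3) t by auto
      finally show ?thesis using \<F>(1,2) U(1) t(2) unfolding T_def
        by (intro CollectI conjI exI[of _ "insert U \<F>"]) auto
    qed
    then show ?thesis using N(1,2) by blast
  qed
  then obtain N where N: "\<And>s. s \<in> ?J \<Longrightarrow> openin X (N s) \<and> s \<in> N s \<and>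
      (\<forall>t\<in>N s \<inter> ?J. \<forall>t'\<in>N s \<inter> ?J. t \<in> T \<longrightarrow> t' \<in> T)" by metis
  let ?E1 = "\<Union>s\<in>T. N s" and ?E2 = "\<Union>s\<in>?J - T. N s"
  have TJ: "T \<subseteq> ?J" by (auto simp: T_def)
  have aT: "a \<in> T"
  proof -
    obtain U where "U \<in> \<U>" "a \<in> U" using cov segment_basic[OF ab] by blast
    then show ?thesis
      using segment_basic[OF ab] segment_refl[OF ab(1)] unfolding T_def
      by (intro CollectI conjI exI[of _ "{U}"]) auto
  qed
  have "openin X ?E1" "openin X ?E2" using N TJ by blast+
  moreover have "?J \<subseteq> ?E1 \<union> ?E2" using N by blast
  moreover have "?E1 \<inter> ?E2 \<inter> ?J = {}"
  proof -
    have "x \<in> T" if "x \<in> ?E1" "x \<in> ?J" for x using that N TJ by blast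
    moreover have "x \<notin> T" if "x \<in> ?E2" "x \<in> ?J" for x using that N by blast
    ultimately show ?thesis by blast
  qed
  moreover have "?E1 \<inter> ?J \<noteq> {}" using aT N TJ by blast
  ultimately have "?E2 \<inter> ?J = {}" using segment_basic(1)[OF ab] unfolding connectedin by meson
  then have "b \<in> T" using N segment_basic[OF ab] by blast
  then show "\<exists>\<F>. finite \<F> \<and> \<F> \<subseteq> \<U> \<and> ?J \<subseteq> \<Union>\<F>" by (auto simp: T_def)
qed

lemma closedin_segment:
  "a \<in> topspace X \<Longrightarrow> b \<in> topspace X \<Longrightarrow> closedin X (K (a, b))"
  using compactin_segment convexity_space_Hausdorff compactin_imp_closedin by blast

text \<open>With only finitely many points nearby, \<open>{a}\<close> would be relatively clopen in
  a connected set that also contains \<open>b\<close>. This provides points of a segment arbitrarily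
  close to its end and different from it.\<close>

lemma segment_not_isolated:
  assumes ab: "a \<in> topspace X" "b \<in> topspace X" "a \<noteq> b" and N: "openin X N" "a \<in> N"
  shows "infinite (K (a, b) \<inter> N)"
proof
  assume fin: "finite (K (a, b) \<inter> N)"
  let ?E = "topspace X - (K (a, b) \<inter> N - {a})"
  let ?D = "topspace X - {a}"
  have "closedin X (K (a, b) \<inter> N - {a})"
    using fin segment_basic(4)[OF ab(1,2)] by (intro closedin_Hausdorff_finite convexity_space_Hausdorff) auto
  then have "openin X (?E \<inter> N)" using N(1) by (intro openin_Int openin_diff) auto
  moreover have "openin X ?D"
    using closedin_Hausdorff_singleton[OF convexity_space_Hausdorff ab(1)] by (intro openin_diff) auto
  moreover have "K (a, b) \<subseteq> (?E \<inter> N) \<union> ?D" "(?E \<inter> N) \<inter> ?D \<inter> K (a, b) = {}"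
    "(?E \<inter> N) \<inter> K (a, b) \<noteq> {}" "?D \<inter> K (a, b) \<noteq> {}"
    using segment_basic[OF ab(1,2)] N ab by blast+
  ultimately show False
    using segment_basic(1)[OF ab(1,2)] unfolding connectedin by meson
qed

end

section \<open>Closed stars and pullbacks\<close>

text \<open>Removes the quantifier over topologies. The finest topology has as closed sets those
  with closed trace on every arm. The arms are compact, hence closed in \<open>X\<close>, so for a
  closed star all these conditions can be tested in \<open>X\<close> itself.\<close>

lemma closed_star_iff:
  assumes cs: "convexity_space X K"
  shows "is_star X K x E \<and> closedin X (star_set K x E) \<longleftrightarrow>
     x \<in> topspace X \<and> E \<subseteq> topspace X - {x} \<and>
     (\<forall>z\<in>E. \<forall>z'\<in>E. z \<noteq> z' \<longrightarrow> K (x, z) \<inter> K (x, z') = {x}) \<and>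
     (\<forall>A. A \<subseteq> star_set K x E \<and> (\<forall>z\<in>E. closedin X (A \<inter> K (x, z))) \<longrightarrow> closedin X A)"
    (is "?L \<longleftrightarrow> ?x \<and> ?E \<and> ?P \<and> ?R")
proof -
  let ?S = "star_set K x E"
  have LR: ?R if L: ?L
  proof (intro allI impI, elim conjE)
    fix A assume A: "A \<subseteq> ?S" "\<forall>z\<in>E. closedin X (A \<inter> K (x, z))"
    \<comment> \<open>The finest topology itself, to be inserted for \<open>T\<close> in the
      definition of a star.\<close>
    define \<tau> where "\<tau> W \<longleftrightarrow> W \<subseteq> ?S \<and> (\<forall>z\<in>E. openin (subtopology X (K (x, z))) (W \<inter> K (x, z)))" for W
    have "istopology \<tau>"
      unfolding istopology_def
    proof (intro conjI allI impI)
      fix S T assume ST: "\<tau> S" "\<tau> T"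
      have "S \<inter> T \<inter> K (x, z) = (S \<inter> K (x, z)) \<inter> (T \<inter> K (x, z))" for z by blast
      then show "\<tau> (S \<inter> T)" using ST unfolding \<tau>_def by (metis openin_Int le_infI1)
    next
      fix \<K> assume K: "\<forall>W\<in>\<K>. \<tau> W"
      have "openin (subtopology X (K (x, z))) (\<Union>W\<in>\<K>. W \<inter> K (x, z))" if "z \<in> E" for z
        using K that unfolding \<tau>_def by (intro openin_Union) auto
      moreover have "\<Union>\<K> \<inter> K (x, z) = (\<Union>W\<in>\<K>. W \<inter> K (x, z))" for z by blast
      ultimately show "\<tau> (\<Union>\<K>)" using K unfolding \<tau>_def by (metis Sup_least)
    qed
    then have op: "openin (topology \<tau>) W \<longleftrightarrow> \<tau> W" for W by simp
    have EX: "K (x, z) \<subseteq> topspace X" if "z \<in> E" for z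
    proof -
      have "x \<in> topspace X" "z \<in> topspace X" using L that by (auto simp: is_star_def)
      then show ?thesis using segment_basic(4)[OF cs] by blast
    qed
    have KS: "K (x, z) \<subseteq> ?S" if "z \<in> E" for z using that by (auto simp: star_set_def)
    have \<tau>S: "\<tau> ?S"
      using KS EX unfolding \<tau>_def by (simp add: Int_absorb1 openin_subtopology_refl)
    have ts: "topspace (topology \<tau>) = ?S"
    proof (rule subset_antisym)
      show "topspace (topology \<tau>) \<subseteq> ?S"
        using op[of "topspace (topology \<tau>)"] unfolding \<tau>_def by simp
      show "?S \<subseteq> topspace (topology \<tau>)" using \<tau>S op openin_subset by blast
    qed
    have cont: "continuous_map (subtopology X (K (x, z))) (topology \<tau>) (\<lambda>p. p)" if z: "z \<in> E" for z
      unfolding continuous_map_def ts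
    proof (intro conjI allI impI)
      show "(\<lambda>p. p) \<in> topspace (subtopology X (K (x, z))) \<rightarrow> ?S" using KS[OF z] by auto
      fix W assume "openin (topology \<tau>) W"
      moreover have "{p \<in> topspace (subtopology X (K (x, z))). p \<in> W} = W \<inter> K (x, z)"
        using EX[OF z] by auto
      ultimately show "openin (subtopology X (K (x, z))) {p \<in> topspace (subtopology X (K (x, z))). p \<in> W}"
        using op z unfolding \<tau>_def by simp
    qed
    have \<tau>A: "\<tau> (?S - A)"
      unfolding \<tau>_def
    proof (intro conjI ballI)
      fix z assume z: "z \<in> E"
      have "closedin (subtopology X (K (x, z))) (A \<inter> K (x, z))"
        using A(2) z by (intro closedin_subset_topspace) auto
      moreover have "(?S - A) \<inter> K (x, z) = topspace (subtopology X (K (x, z))) - A \<inter> K (x, z)"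
        using EX[OF z] KS[OF z] by auto
      ultimately show "openin (subtopology X (K (x, z))) ((?S - A) \<inter> K (x, z))"
        by (simp only: closedin_def)
    qed auto
    have star: "\<forall>T. topspace T = ?S \<and> (\<forall>z\<in>E. continuous_map (subtopology X (K (x, z))) T (\<lambda>p. p)) \<longrightarrow>
        (\<forall>W. openin T W \<longrightarrow> openin (subtopology X ?S) W)"
      using L unfolding is_star_def by (elim conjE)
    have "openin (subtopology X ?S) (?S - A)"
      by (rule star[rule_format, OF conjI[OF ts ballI[OF cont]]]) (simp_all add: op \<tau>A)
    moreover have SX: "?S \<subseteq> topspace X" using EX by (auto simp: star_set_def)
    moreover have "topspace (subtopology X ?S) - (?S - A) = A" using SX A(1) by auto
    ultimately have "closedin (subtopology X ?S) A" by (metis closedin_diff closedin_topspace)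
    then show "closedin X A" using L closedin_trans_full by blast
  qed
  have RL: ?L if R: "?x \<and> ?E \<and> ?P \<and> ?R"
  proof -
    have cl: "closedin X (K (x, z))" if "z \<in> E" for z
      using R that by (intro closedin_segment[OF cs]) auto
    have KS: "K (x, z) \<subseteq> ?S" if "z \<in> E" for z using that by (auto simp: star_set_def)
    have SX: "?S \<subseteq> topspace X"
      unfolding star_set_def using cl by (intro UN_least closedin_subset)
    have fine: "\<forall>A. A \<subseteq> ?S \<and> (\<forall>z\<in>E. closedin X (A \<inter> K (x, z))) \<longrightarrow> closedin X A"
      using R by (elim conjE)
    \<comment> \<open>Closedness of the star is the criterion for \<open>A\<close> the whole star,
      whose traces are the arms.\<close>
    have "closedin X (?S \<inter> K (x, z))" if "z \<in> E" for z
      using cl[OF that] KS[OF that] by (simp only: inf.absorb2)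
    then have "closedin X ?S" using fine by blast
    moreover have "is_star X K x E"
      unfolding is_star_def
    proof (intro conjI allI impI)
      fix T W assume T: "topspace T = ?S \<and>
          (\<forall>z\<in>E. continuous_map (subtopology X (K (x, z))) T (\<lambda>p. p))" and W: "openin T W"
      have "closedin X ((?S - W) \<inter> K (x, z))" if z: "z \<in> E" for z
      proof -
        have "closedin T (?S - W)" using T W by (metis closedin_diff closedin_topspace openin_closedin_eq)
        then have "closedin (subtopology X (K (x, z))) {p \<in> topspace (subtopology X (K (x, z))). p \<in> ?S - W}"
          using T z closedin_continuous_map_preimage[of _ T "\<lambda>p. p"] by blast
        moreover have "{p \<in> topspace (subtopology X (K (x, z))). p \<in> ?S - W} = (?S - W) \<inter> K (x, z)"
          using closedin_subset[OF cl[OF z]] by auto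
        ultimately show ?thesis using cl[OF z] closedin_trans_full by metis
      qed
      then have "closedin X (?S - W)" using fine by blast
      then have "closedin (subtopology X ?S) (?S - W)"
        by (intro closedin_subset_topspace) auto
      moreover have "topspace (subtopology X ?S) - (?S - W) = W"
        using SX openin_subset[OF W] T by auto
      ultimately show "openin (subtopology X ?S) W" by (metis openin_diff openin_topspace)
    qed (use R in auto)
    ultimately show ?L by simp
  qed
  show ?thesis
  proof (rule iffI)
    assume L: ?L
    then have "?x \<and> ?E \<and> ?P" unfolding is_star_def by (elim conjE, intro conjI)
    then show "?x \<and> ?E \<and> ?P \<and> ?R" using LR[OF L] by (elim conjE, intro conjI)
  qed (rule RL)
qed

text \<open>Convexity of the image ensures that \<open>f\<close> maps each pulled back segment onto
  the entire segment of \<open>X\<close> (the fact \<open>fk\<close>); the axioms are then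
  transported along the homeomorphism. The image need not be open.\<close>

lemma convexity_space_pullback:
  assumes cs: "convexity_space X K"
    and f: "homeomorphic_map D (subtopology X (f ` topspace D)) f"
    and conv: "convex_subset (topspace X) K (f ` topspace D)"
  shows "convexity_space D
    (restrict (\<lambda>(a, b). {z \<in> topspace D. f z \<in> K (f a, f b)}) (topspace D \<times> topspace D))"
    (is "convexity_space D ?K")
proof -
  define k where "k = ?K"
  let ?P = "f ` topspace D"
  have PX: "?P \<subseteq> topspace X" using conv by (simp add: convex_subset_def)
  have inj: "inj_on f (topspace D)" using f homeomorphic_imp_injective_map by blast
  have k: "k (a, b) = {z \<in> topspace D. f z \<in> K (f a, f b)}"
    if "a \<in> topspace D" "b \<in> topspace D" for a b using that by (simp add: k_def)
  have KP: "K (f a, f b) \<subseteq> ?P" if "a \<in> topspace D" "b \<in> topspace D" for a b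
    using conv that by (simp add: convex_subset_def)
  have fk: "f ` k (a, b) = K (f a, f b)" if "a \<in> topspace D" "b \<in> topspace D" for a b
    using KP[OF that] k[OF that] by blast
  have fX: "f a \<in> topspace X" if "a \<in> topspace D" for a using that PX by blast
  have conn: "connectedin X (f ` B) \<longleftrightarrow> connectedin D B" if "B \<subseteq> topspace D" for B
    using homeomorphic_map_connectedness[OF f that] that by (auto simp: connectedin_subtopology)
  have cont: "continuous_map D X f"
    using f homeomorphic_imp_continuous_map continuous_map_into_fulltopology by blast
  have image_open: "\<exists>U'. openin X U' \<and> f ` U = U' \<inter> ?P" if "openin D U" for U
    using homeomorphic_map_openness_eq[OF f] that by (auto simp: openin_subtopology)
  have "Hausdorff_space D"
    using homeomorphic_Hausdorff_space[OF homeomorphic_map_imp_homeomorphic_space[OF f]]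
      Hausdorff_space_subtopology[OF convexity_space_Hausdorff[OF cs]] by blast
  moreover have "k \<in> extensional (topspace D \<times> topspace D)" by (simp add: k_def)
  moreover have "continuous_map (prod_topology D D) (powerset_topology D) k"
    unfolding continuous_map_powerset_topology
  proof (intro conjI ballI allI impI)
    show "k (a, b) \<subseteq> topspace D" if "a \<in> topspace D" "b \<in> topspace D" for a b
      using k[OF that] by simp
    fix a b U assume ab: "a \<in> topspace D" "b \<in> topspace D" and U: "openin D U \<and> k (a, b) \<subseteq> U"
    obtain U' where U': "openin X U'" "f ` U = U' \<inter> ?P" using image_open[of U] U by blast
    have "K (f a, f b) \<subseteq> U'" using fk[OF ab] U U'(2) by blast
    then have "\<exists>M N. openin X M \<and> openin X N \<and> f a \<in> M \<and> f b \<in> N \<and>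
        (\<forall>a'\<in>M. \<forall>b'\<in>N. K (a', b') \<subseteq> U')"
      using cs U'(1) fX[OF ab(1)] fX[OF ab(2)]
      unfolding convexity_space_def continuous_map_powerset_topology by simp
    then obtain M N where MN: "openin X M" "openin X N" "f a \<in> M" "f b \<in> N"
      "\<And>a' b'. a' \<in> M \<Longrightarrow> b' \<in> N \<Longrightarrow> K (a', b') \<subseteq> U'" by blast
    let ?M = "{z \<in> topspace D. f z \<in> M}" and ?N = "{z \<in> topspace D. f z \<in> N}"
    have "k (a', b') \<subseteq> U" if "a' \<in> ?M" "b' \<in> ?N" for a' b'
    proof
      fix z assume "z \<in> k (a', b')"
      then have z: "z \<in> topspace D" "f z \<in> K (f a', f b')" using k[of a' b'] that by auto
      then have "f z \<in> f ` U" using MN(5)[of "f a'" "f b'"] that U'(2) by auto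
      then show "z \<in> U"
        using inj z(1) openin_subset U by (metis inj_on_image_mem_iff)
    qed
    moreover have "openin D ?M" "openin D ?N"
      using openin_continuous_map_preimage[OF cont] MN(1,2) by auto
    moreover have "a \<in> ?M" "b \<in> ?N" using ab MN(3,4) by auto
    ultimately show "\<exists>M N. openin D M \<and> openin D N \<and> a \<in> M \<and> b \<in> N \<and>
        (\<forall>a'\<in>M. \<forall>b'\<in>N. k (a', b') \<subseteq> U)"
      by (intro exI[of _ ?M] exI[of _ ?N]) simp
  qed
  moreover have "\<forall>x\<in>topspace D. \<forall>y\<in>topspace D. convex_subset (topspace D) k (k (x, y))"
  proof (intro ballI)
    fix a b assume ab: "a \<in> topspace D" "b \<in> topspace D"
    have "k (c, d) \<subseteq> k (a, b)" if "c \<in> k (a, b)" "d \<in> k (a, b)" for c d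
    proof -
      have cd: "c \<in> topspace D" "d \<in> topspace D" "f c \<in> K (f a, f b)" "f d \<in> K (f a, f b)"
        using that k[OF ab] by auto
      show ?thesis
        using segment_mono[OF cs fX[OF ab(1)] fX[OF ab(2)] cd(3,4)] k[OF ab] k[OF cd(1,2)] by blast
    qed
    then show "convex_subset (topspace D) k (k (a, b))"
      using k[OF ab] unfolding convex_subset_def by blast
  qed
  moreover have "\<forall>x\<in>topspace D. \<forall>y\<in>topspace D.
        connectedin D (k (x, y)) \<and> x \<in> k (x, y) \<and> y \<in> k (x, y) \<and>
        (\<forall>B. connectedin D B \<and> x \<in> B \<and> y \<in> B \<and> B \<subseteq> k (x, y) \<longrightarrow> B = k (x, y))"
  proof (intro ballI)
    fix a b assume ab: "a \<in> topspace D" "b \<in> topspace D"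
    note seg = segment_basic[OF cs fX[OF ab(1)] fX[OF ab(2)]]
    have sub: "k (a, b) \<subseteq> topspace D" using k[OF ab] by blast
    have "B = k (a, b)" if B: "connectedin D B" "a \<in> B" "b \<in> B" "B \<subseteq> k (a, b)" for B
    proof -
      have "f ` B = f ` k (a, b)"
        unfolding fk[OF ab]
      proof (rule segment_minimal[OF cs fX[OF ab(1)] fX[OF ab(2)]])
        show "connectedin X (f ` B)" using conn B(1,4) sub by blast
        show "f ` B \<subseteq> K (f a, f b)" using B(4) k[OF ab] by blast
      qed (use B in auto)
      then show ?thesis using inj B(4) sub by (metis inj_on_image_eq_iff subset_trans)
    qed
    moreover have "connectedin D (k (a, b))" using conn[OF sub] fk[OF ab] seg by simp
    ultimately show "connectedin D (k (a, b)) \<and> a \<in> k (a, b) \<and> b \<in> k (a, b) \<and>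
        (\<forall>B. connectedin D B \<and> a \<in> B \<and> b \<in> B \<and> B \<subseteq> k (a, b) \<longrightarrow> B = k (a, b))"
      using seg ab k[OF ab] by auto
  qed
  moreover have "\<forall>U x. openin D U \<and> x \<in> U \<longrightarrow>
        (\<exists>W. openin D W \<and> convex_subset (topspace D) k W \<and> x \<in> W \<and> W \<subseteq> U)"
  proof (intro allI impI)
    fix U x assume U: "openin D U \<and> x \<in> U"
    then have UD: "U \<subseteq> topspace D" by (simp add: openin_subset)
    obtain U' where U': "openin X U'" "f ` U = U' \<inter> ?P" using image_open[of U] U by blast
    have "f x \<in> U'" using U U'(2) by blast
    then obtain W' where W': "openin X W'" "convex_subset (topspace X) K W'" "f x \<in> W'" "W' \<subseteq> U'"
      using cs U'(1) unfolding convexity_space_def by meson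
    let ?W = "{z \<in> topspace D. f z \<in> W'}"
    have "openin D ?W" using openin_continuous_map_preimage[OF cont W'(1)] .
    moreover have "convex_subset (topspace D) k ?W"
    proof -
      have "K (f a, f b) \<subseteq> W'" if "a \<in> ?W" "b \<in> ?W" for a b
        using W'(2) that by (simp add: convex_subset_def)
      then have "k (a, b) \<subseteq> ?W" if "a \<in> ?W" "b \<in> ?W" for a b
        using k[of a b] that by blast
      then show ?thesis by (auto simp: convex_subset_def)
    qed
    moreover have "x \<in> ?W" using U UD W'(3) by blast
    moreover have "?W \<subseteq> U"
    proof
      fix z assume z: "z \<in> ?W"
      then have "f z \<in> f ` U" using W'(4) U'(2) by blast
      then show "z \<in> U" using inj z UD by (metis (no_types, lifting) inj_on_image_mem_iff mem_Collect_eq)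
    qed
    ultimately show "\<exists>W. openin D W \<and> convex_subset (topspace D) k W \<and> x \<in> W \<and> W \<subseteq> U" by blast
  qed
  ultimately have "convexity_space D k" unfolding convexity_space_def by (intro conjI)
  then show ?thesis by (simp only: k_def)
qed

section \<open>Compatibility of charts\<close>

context
  fixes Y :: "'a topology" and \<V> :: "'a atlas"
  assumes lcs: "local_convexity_structure Y \<V>"
begin

lemma chart:
  assumes "(V, K) \<in> \<V>"
  shows "openin Y V" "V \<subseteq> topspace Y" "convexity_space (subtopology Y V) K"
    "topspace (subtopology Y V) = V"
proof -
  show "openin Y V" "convexity_space (subtopology Y V) K"
    using lcs assms by (auto simp: local_convexity_structure_def)
  then show "V \<subseteq> topspace Y" "topspace (subtopology Y V) = V"
    using openin_subset[of Y V] by (auto simp: topspace_subtopology_subset)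
qed

lemma chart_segment:
  assumes V: "(V, K) \<in> \<V>" and pq: "p \<in> V" "q \<in> V"
  shows "connectedin Y (K (p, q))" "p \<in> K (p, q)" "q \<in> K (p, q)" "K (p, q) \<subseteq> V"
    "compactin Y (K (p, q))"
  using segment_basic[OF chart(3)[OF V], of p q] compactin_segment[OF chart(3)[OF V], of p q]
    pq chart(2)[OF V]
  by (auto simp: connectedin_subtopology compactin_subtopology)

lemma chart_minimal:
  assumes V: "(V, K) \<in> \<V>" and pq: "p \<in> V" "q \<in> V"
    and B: "connectedin Y B" "p \<in> B" "q \<in> B" "B \<subseteq> K (p, q)"
  shows "B = K (p, q)"
  using segment_minimal[OF chart(3)[OF V], unfolded chart(4)[OF V], OF pq _ B(2-4)] B(1)
    subset_trans[OF B(4) chart_segment(4)[OF V pq]]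
  by (simp add: connectedin_subtopology)

lemma chart_segment_sub_connected:
  assumes V: "(V, K) \<in> \<V>" and pq: "p \<in> V" "q \<in> V"
    and B: "connectedin Y B" "B \<subseteq> K (p, q)" "a \<in> B" "b \<in> B"
  shows "K (a, b) \<subseteq> B"
  using segment_sub_connected[OF chart(3)[OF V], unfolded chart(4)[OF V], OF pq _ B(2-4)] B(1)
    subset_trans[OF B(2) chart_segment(4)[OF V pq]]
  by (simp add: connectedin_subtopology)

text \<open>(C3), combined with the closure of the atlas under convex open subspaces.\<close>

lemma chart_convex_nbhd:
  assumes V: "(V, K) \<in> \<V>" and "openin Y U" "y \<in> U" "y \<in> V"
  obtains W where "openin Y W" "convex_subset V K W" "y \<in> W" "W \<subseteq> U"
    "(W, restrict K (W \<times> W)) \<in> \<V>"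
proof -
  have "openin (subtopology Y V) (U \<inter> V)" using assms(2) openin_subtopology by blast
  then obtain W where W: "openin (subtopology Y V) W" "convex_subset V K W" "y \<in> W" "W \<subseteq> U \<inter> V"
    using chart(3)[OF V] assms(3,4) chart(4)[OF V] unfolding convexity_space_def by (metis IntI)
  moreover have "openin Y W" using W(1) chart(1)[OF V] openin_trans_full by blast
  moreover have "(W, restrict K (W \<times> W)) \<in> \<V>"
    using lcs V W(1,2) by (force simp: local_convexity_structure_def)
  ultimately show thesis using that by blast
qed

end

text \<open>The inclusion of the compact segment \<open>K (p, q)\<close> is an etale map. By (G2) it is not generated by
  \<open>x, y\<close>, so that \<open>x\<close> and \<open>y\<close> lie in a proper connected subset which is convex in every chart.\<close>

lemma charts_agree_on_proper_subsegments:
  assumes Y: "geodesic_manifold Y \<V>" and V: "(V, K) \<in> \<V>" and V': "(V', K') \<in> \<V>"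
    and pq: "p \<in> V" "q \<in> V" and xy: "x \<in> K (p, q)" "y \<in> K (p, q)" "x \<in> V'" "y \<in> V'"
    and ne: "K (x, y) \<noteq> K (p, q)"
  shows "K' (x, y) = K (x, y)"
proof -
  have lcs: "local_convexity_structure Y \<V>" using Y by (simp add: geodesic_manifold_def)
  let ?J = "K (p, q)"
  let ?C = "subtopology Y ?J"
  note J = chart_segment[OF lcs V pq]
  have JY: "topspace ?C = ?J" using J(4) chart(2)[OF lcs V] by auto
  have xyV: "x \<in> V" "y \<in> V" using xy J(4) by auto
  have Jconv: "convex_subset V K ?J"
    using chart(3)[OF lcs V] chart(4)[OF lcs V] pq by (simp add: convexity_space_def)
  have JU: "?J \<in> fst ` induced_atlas ?C Y \<V> id"
    unfolding fst_induced_atlas mem_Collect_eq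
  proof (intro conjI)
    show "openin ?C ?J" using openin_topspace[of ?C] unfolding JY .
    show "\<exists>V K. (V, K) \<in> \<V> \<and> convex_subset V K (id ` ?J)" using V Jconv by auto
    show "homeomorphic_map (subtopology ?C ?J) (subtopology Y (id ` ?J)) id"
      by (simp add: subtopology_subtopology)
  qed
  have et: "etale_map ?C Y \<V> id"
    unfolding etale_map_def
  proof (intro conjI)
    have Haus: "Hausdorff_space Y" using Y by (simp add: geodesic_manifold_def)
    then show "Hausdorff_space ?C" by (rule Hausdorff_space_subtopology)
    show "connected_space ?C" using J(1) connectedin_def by blast
    show "continuous_map ?C Y id" by (simp add: continuous_map_from_subtopology)
    show "closed_map ?C Y id"
      using closedin_trans_full compactin_imp_closedin[OF Haus J(5)] by (fastforce simp: closed_map_def)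
    have "\<Union>(fst ` induced_atlas ?C Y \<V> id) \<subseteq> topspace ?C"
      unfolding fst_induced_atlas using openin_subset by blast
    then show "\<Union>(fst ` induced_atlas ?C Y \<V> id) = topspace ?C" using JU JY by blast
  qed
  have comp: "compact_space ?C" using J(5) by (simp add: compact_space_subtopology)
  have conn: "connectedin ?C (K (x, y))"
    using chart_segment[OF lcs V xyV] chart_segment_sub_connected[OF lcs V pq J(1) subset_refl xy(1,2)]
    by (simp add: connectedin_subtopology)
  have "\<not> etale_generated_by ?C Y \<V> id {x, y}"
  proof
    assume "etale_generated_by ?C Y \<V> id {x, y}"
    from geodesic_manifold_etale_minimal[OF Y et comp this conn chart_segment(2,3)[OF lcs V xyV]]
    show False using ne JY by simp
  qed
  moreover have "{x, y} \<subseteq> topspace ?C" unfolding JY using xy by simp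
  ultimately obtain A where A: "connectedin ?C A" "{x, y} \<subseteq> A" "A \<subset> topspace ?C"
      "\<forall>U\<in>fst ` induced_atlas ?C Y \<V> id. locally_convex_subset Y \<V> (id ` (U \<inter> A))"
    unfolding etale_generated_by_def by blast
  have AJ: "A \<subset> ?J" using A(3) unfolding JY .
  have "locally_convex_subset Y \<V> (id ` (?J \<inter> A))" using A(4) JU by (rule bspec)
  then have "locally_convex_subset Y \<V> A" using AJ by (simp add: Int_absorb1 psubset_imp_subset)
  then have "convex_subset V' K' (A \<inter> V')"
    using V' by (auto simp: locally_convex_subset_def)
  then have "K' (x, y) \<subseteq> A" using A(2) xy(3,4) by (auto simp: convex_subset_def)
  then have "K' (x, y) \<subseteq> ?J" using AJ by blast
  then have "K (x, y) \<subseteq> K' (x, y)"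
    using chart_segment_sub_connected[OF lcs V pq] chart_segment[OF lcs V' xy(3,4)] by blast
  then show ?thesis
    using chart_minimal[OF lcs V' xy(3,4)] chart_segment[OF lcs V xyV] by metis
qed

text \<open>Let the second end point of a proper subsegment of \<open>K (p, q)\<close> tend to \<open>q\<close>.\<close>

lemma charts_agree:
  assumes Y: "geodesic_manifold Y \<V>" and V: "(V, K) \<in> \<V>" and V': "(V', K') \<in> \<V>"
    and p: "p \<in> V" "p \<in> V'" and q: "q \<in> V" "q \<in> V'"
  shows "K (p, q) = K' (p, q)"
proof -
  have lcs: "local_convexity_structure Y \<V>" using Y by (simp add: geodesic_manifold_def)
  let ?X = "subtopology Y V" and ?X' = "subtopology Y V'"
  note cs = chart(3)[OF lcs V] and tV = chart(4)[OF lcs V]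
  note cs' = chart(3)[OF lcs V'] and tV' = chart(4)[OF lcs V']
  note sym = segment_sym[OF cs, unfolded tV] and through = segment_through[OF cs, unfolded tV]
    and mono = segment_mono[OF cs, unfolded tV] and anti = segment_antisym[OF cs, unfolded tV]
  note J = chart_segment[OF lcs V p(1) q(1)] and J' = chart_segment[OF lcs V' p(2) q(2)]
  have "K (p, q) \<subseteq> K' (p, q)"
  proof (rule ccontr)
    assume "\<not> ?thesis"
    then obtain r where r: "r \<in> K (p, q)" "r \<notin> K' (p, q)" by blast
    have rV: "r \<in> V" using r J by blast
    have rq: "r \<noteq> q" using r J' by blast
    \<comment> \<open>By continuity of \<open>K'\<close>, the point \<open>r\<close> stays outside
      \<open>K' (p, y)\<close> for all \<open>y\<close> near \<open>q\<close>. But for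
      \<open>y \<noteq> q\<close> in \<open>K (r, q)\<close> near \<open>q\<close>, the segment
      \<open>K (p, y)\<close> contains \<open>r\<close> and is proper in \<open>K (p, q)\<close>, so
      it equals \<open>K' (p, y)\<close>.\<close>
    have "openin Y (V' - {r})"
      using chart(1)[OF lcs V'] Y rV chart(2)[OF lcs V]
      by (auto simp: geodesic_manifold_def intro!: openin_diff closedin_Hausdorff_singleton)
    then have "openin ?X' (V' - {r})" using chart(1)[OF lcs V'] by (auto simp: openin_open_subtopology)
    moreover have "K' (p, q) \<subseteq> V' - {r}" using r J' by blast
    ultimately have "\<exists>M N. openin ?X' M \<and> openin ?X' N \<and> p \<in> M \<and> q \<in> N \<and>
        (\<forall>a'\<in>M. \<forall>b'\<in>N. K' (a', b') \<subseteq> V' - {r})"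
      using cs' p q tV' unfolding convexity_space_def continuous_map_powerset_topology by simp
    then obtain N where N: "openin ?X' N" "q \<in> N" "\<And>y. y \<in> N \<Longrightarrow> K' (p, y) \<subseteq> V' - {r}" by blast
    have "openin Y N" "N \<subseteq> V'" using N(1) chart(1)[OF lcs V'] openin_open_subtopology by blast+
    then have "openin ?X (N \<inter> V)" using openin_subtopology by blast
    then have "infinite (K (q, r) \<inter> (N \<inter> V))"
      using segment_not_isolated[OF cs, of q r] rV q rq N(2) tV by blast
    then have "\<not> K (q, r) \<inter> (N \<inter> V) \<subseteq> {q}" using finite_subset by blast
    then obtain y where y: "y \<in> K (q, r)" "y \<in> N" "y \<in> V" "y \<noteq> q" by blast
    then have yr: "y \<in> K (r, q)" using sym[OF q(1) rV] by simp
    then have "r \<in> K (p, y)" using through[OF p(1) q(1) r(1)] by blast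
    moreover have "y \<in> K (p, q)" using mono[OF p(1) q(1) r(1) J(3)] yr by blast
    moreover have "K (p, y) \<noteq> K (p, q)"
    proof
      assume "K (p, y) = K (p, q)"
      then have "q \<in> K (p, y)" using J by simp
      then have "q \<in> K (y, p)" using sym[OF p(1) y(3)] by simp
      moreover have "y \<in> K (q, p)"
        using \<open>y \<in> K (p, q)\<close> sym[OF p(1) q(1)] by simp
      ultimately show False using anti[OF q(1) p(1)] y(4) by blast
    qed
    ultimately have "r \<in> K' (p, y)"
      using charts_agree_on_proper_subsegments[OF Y V V' p(1) q(1), of p y] J(2) p y(2) \<open>N \<subseteq> V'\<close>
      by blast
    then show False using N(3)[OF y(2)] by blast
  qed
  then show ?thesis using chart_minimal[OF lcs V' p(2) q(2)] J by blast
qed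

section \<open>Sheets of etale maps\<close>

text \<open>The topological half of membership in the induced atlas. Convexity of the image is kept
  apart, since it will be required in a chart chosen in advance.\<close>

definition sheet :: "'c topology \<Rightarrow> 'a topology \<Rightarrow> ('c \<Rightarrow> 'a) \<Rightarrow> 'c set \<Rightarrow> bool" where
  "sheet C Y e U \<longleftrightarrow>
     openin C U \<and> homeomorphic_map (subtopology C U) (subtopology Y (e ` U)) e"

lemma sheetD:
  assumes "sheet C Y e U"
  shows "openin C U" "homeomorphic_map (subtopology C U) (subtopology Y (e ` U)) e"
    "U \<subseteq> topspace C" "topspace (subtopology C U) = U" "inj_on e U" "e ` U \<subseteq> topspace Y"
proof -
  show *: "openin C U" "homeomorphic_map (subtopology C U) (subtopology Y (e ` U)) e"
    using assms by (simp_all add: sheet_def)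
  show "U \<subseteq> topspace C" using *(1) by (rule openin_subset)
  then show U: "topspace (subtopology C U) = U" by (rule topspace_subtopology_subset)
  show "inj_on e U" using homeomorphic_imp_injective_map[OF *(2)] unfolding U .
  show "e ` U \<subseteq> topspace Y"
    using homeomorphic_imp_surjective_map[OF *(2), unfolded U, unfolded topspace_subtopology]
    by (rule subset_trans[OF equalityD1 Int_lower1])
qed

lemma sheet_Int:
  assumes U: "sheet C Y e U" and "openin C W"
  shows "sheet C Y e (U \<inter> W)"
  unfolding sheet_def
proof
  show "openin C (U \<inter> W)" using sheetD(1)[OF U] assms(2) by blast
  have "homeomorphic_map (subtopology (subtopology C U) (U \<inter> W))
      (subtopology (subtopology Y (e ` U)) (e ` (U \<inter> W))) e"
    using sheetD(4,6)[OF U] by (intro homeomorphic_map_subtopologies[OF sheetD(2)[OF U]]) auto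
  moreover have "e ` U \<inter> e ` (U \<inter> W) = e ` (U \<inter> W)" "U \<inter> (U \<inter> W) = U \<inter> W" by auto
  ultimately show "homeomorphic_map (subtopology C (U \<inter> W)) (subtopology Y (e ` (U \<inter> W))) e"
    by (simp add: subtopology_subtopology)
qed

text \<open>The lifts of \<open>J\<close> to \<open>U\<close> and to \<open>U'\<close> agree on a closed subset of \<open>J\<close>, since \<open>C\<close> is
  Hausdorff, and this subset consists of the points whose lift to \<open>U\<close> lies in the open set \<open>U'\<close>.\<close>

lemma sheet_lift_unique:
  assumes C: "Hausdorff_space C" and U: "sheet C Y e U" and U': "sheet C Y e U'"
    and J: "connectedin Y J" "J \<subseteq> e ` U" "J \<subseteq> e ` U'"
    and s: "s \<in> U" "s \<in> U'" "e s \<in> J" and t: "t \<in> U" "e t \<in> J"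
  shows "t \<in> U'"
proof -
  let ?X = "subtopology Y J"
  have X: "topspace ?X = J"
    by (rule topspace_subtopology_subset[OF connectedin_subset_topspace[OF J(1)]])
  have inverse: "\<exists>g. continuous_map ?X C g \<and> (\<forall>j\<in>J. g j \<in> W \<and> e (g j) = j) \<and> (\<forall>u\<in>W. g (e u) = u)"
    if W: "sheet C Y e W" "J \<subseteq> e ` W" for W
  proof -
    obtain g where g: "homeomorphic_maps (subtopology C W) (subtopology Y (e ` W)) e g"
      using sheetD(2)[OF W(1)] homeomorphic_map_maps by blast
    then have cont: "continuous_map (subtopology Y (e ` W)) (subtopology C W) g"
      and ge: "\<forall>u\<in>W. g (e u) = u"
      using sheetD(4)[OF W(1)] by (auto simp: homeomorphic_maps_def)
    have "continuous_map (subtopology Y (e ` W)) C g"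
      using cont continuous_map_in_subtopology by blast
    then have "continuous_map ?X C g"
      using W(2) by (rule continuous_map_from_subtopology_mono)
    moreover have "g j \<in> W \<and> e (g j) = j" if "j \<in> J" for j
      using that W(2) ge by (auto simp: subset_iff)
    ultimately show ?thesis using ge by blast
  qed
  obtain g where g: "continuous_map ?X C g" "\<And>j. j \<in> J \<Longrightarrow> g j \<in> U" "\<And>j. j \<in> J \<Longrightarrow> e (g j) = j"
      "\<And>u. u \<in> U \<Longrightarrow> g (e u) = u"
    using inverse[OF U J(2)] by blast
  obtain g' where g': "continuous_map ?X C g'" "\<And>j. j \<in> J \<Longrightarrow> g' j \<in> U'"
      "\<And>u. u \<in> U' \<Longrightarrow> g' (e u) = u"
    using inverse[OF U' J(3)] by blast
  let ?E = "{j \<in> topspace ?X. g j \<in> U'}"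
  have "?E = {j \<in> topspace ?X. g j = g' j}"
    using g(3) g'(2,3) unfolding X by (metis (lifting))
  then have "closedin ?X ?E" using closedin_continuous_maps_eq[OF C g(1) g'(1)] by simp
  moreover have "openin ?X ?E" using openin_continuous_map_preimage[OF g(1) sheetD(1)[OF U']] .
  moreover have "connected_space ?X" using J(1) by (simp add: connectedin_def)
  ultimately have "?E = {} \<or> ?E = topspace ?X" unfolding connected_space_clopen_in by blast
  moreover have "e s \<in> ?E" using s g(4) X by simp
  ultimately have "e t \<in> ?E" using t(2) X by blast
  then show ?thesis using g(4)[OF t(1)] by simp
qed

text \<open>The segment from \<open>e c\<close> to \<open>e s\<close> lies in both images and lifts
  to both sheets through the common point \<open>s\<close>. Unique lifting puts \<open>c\<close>
  into \<open>U'\<close>, where \<open>e\<close> is injective. So sheets at different points of a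
  fibre are disjoint once their images are convex in the same chart.\<close>

lemma sheets_disjoint:
  assumes lcs: "local_convexity_structure Y \<V>" and C: "Hausdorff_space C" and V: "(V, K) \<in> \<V>"
    and U: "sheet C Y e U" "convex_subset V K (e ` U)"
    and U': "sheet C Y e U'" "convex_subset V K (e ` U')"
    and c: "c \<in> U" "c' \<in> U'" "e c = e c'" and s: "s \<in> U" "s \<in> U'"
  shows "c = c'"
proof -
  let ?J = "K (e c, e s)"
  have cV: "e c \<in> V" "e s \<in> V" using U(2) c s by (auto simp: convex_subset_def)
  note J = chart_segment[OF lcs V cV]
  have "?J \<subseteq> e ` U" using convex_subsetD(2)[OF U(2)] c s by blast
  moreover have "?J \<subseteq> e ` U'"
  proof -
    have "e c \<in> e ` U'" "e s \<in> e ` U'" using c s by auto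
    then show ?thesis by (rule convex_subsetD(2)[OF U'(2)])
  qed
  ultimately have "c \<in> U'"
    using sheet_lift_unique[OF C U(1) U'(1) J(1) _ _ s J(3) c(1) J(2)] by blast
  then show ?thesis using sheetD(5)[OF U'(1)] c by (simp add: inj_on_def)
qed

lemma induced_atlas_iff:
  "(U, k) \<in> induced_atlas C Y \<V> e \<longleftrightarrow>
     (\<exists>V K. (V, K) \<in> \<V> \<and> sheet C Y e U \<and> convex_subset V K (e ` U) \<and>
        k = restrict (\<lambda>(x, y). {z \<in> U. e z \<in> K (e x, e y)}) (U \<times> U))"
  unfolding induced_atlas_def sheet_def by auto

lemma etale_sheet:
  assumes Y: "geodesic_manifold Y \<V>" and e: "etale_map C Y \<V> e" and V: "(V, K) \<in> \<V>"
    and c: "c \<in> topspace C" "e c \<in> V"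
  obtains U where "c \<in> U" "sheet C Y e U" "convex_subset V K (e ` U)"
proof -
  have lcs: "local_convexity_structure Y \<V>" using Y by (simp add: geodesic_manifold_def)
  have "c \<in> \<Union>(fst ` induced_atlas C Y \<V> e)" and cont: "continuous_map C Y e"
    using e c(1) by (simp_all add: etale_map_def)
  then obtain U0 where "U0 \<in> fst ` induced_atlas C Y \<V> e" "c \<in> U0" by (elim UnionE)
  then obtain V0 K0 where U0: "(V0, K0) \<in> \<V>" "sheet C Y e U0" "convex_subset V0 K0 (e ` U0)" "c \<in> U0"
    unfolding fst_induced_atlas sheet_def by blast
  let ?W = "{t \<in> topspace C. e t \<in> V}"
  have "openin C ?W" using openin_continuous_map_preimage[OF cont chart(1)[OF lcs V]] .
  then have sh: "sheet C Y e (U0 \<inter> ?W)" using sheet_Int[OF U0(2)] by blast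
  have im: "e ` (U0 \<inter> ?W) = e ` U0 \<inter> V" using sheetD(3)[OF U0(2)] by auto
  have "K (p, q) \<subseteq> e ` U0 \<inter> V" if pq: "p \<in> e ` U0 \<inter> V" "q \<in> e ` U0 \<inter> V" for p q
  proof -
    have "p \<in> V" "q \<in> V" "p \<in> V0" "q \<in> V0" using pq U0(3) by (auto simp: convex_subset_def)
    then have "K (p, q) = K0 (p, q)" "K (p, q) \<subseteq> V"
      using charts_agree[OF Y V U0(1)] chart_segment(4)[OF lcs V] by blast+
    moreover have "K0 (p, q) \<subseteq> e ` U0" using convex_subsetD(2)[OF U0(3)] pq by blast
    ultimately show ?thesis by simp
  qed
  then have conv: "convex_subset V K (e ` (U0 \<inter> ?W))" 
    unfolding im convex_subset_def by blast
  have "c \<in> U0 \<inter> ?W" using c U0(4) by blast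
  then show thesis using sh conv by (rule that)
qed

text \<open>Closedness of \<open>e\<close> enters through the neighbourhood \<open>W\<close> of \<open>y\<close>, whose preimage is the
  disjoint union of the open sets \<open>S c \<inter> e -` W\<close>.\<close>

lemma etale_evenly_covered:
  assumes lcs: "local_convexity_structure Y \<V>" and e: "etale_map C Y \<V> e"
    and V: "(V, K) \<in> \<V>" and y: "y \<in> V"
    and S: "\<And>c. c \<in> topspace C \<Longrightarrow> e c = y \<Longrightarrow>
      c \<in> S c \<and> sheet C Y e (S c) \<and> convex_subset V K (e ` S c)"
  obtains W where "openin Y W" "convex_subset V K W" "y \<in> W" "(W, restrict K (W \<times> W)) \<in> \<V>"
    "\<forall>Q. (\<forall>c\<in>{c \<in> topspace C. e c = y}. closedin (subtopology Y (e ` S c \<inter> W)) (Q c)) \<longrightarrow>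
       closedin (subtopology Y W) (\<Union>c\<in>{c \<in> topspace C. e c = y}. Q c)"
proof -
  let ?F = "{c \<in> topspace C. e c = y}"
  have C: "Hausdorff_space C" and cont: "continuous_map C Y e" and closed: "closed_map C Y e"
    using e by (auto simp: etale_map_def)
  have op: "openin C (\<Union>c\<in>?F. S c)" using S sheetD(1) by blast
  then have "closedin C (topspace C - (\<Union>c\<in>?F. S c))" by blast
  then have "closedin Y (e ` (topspace C - (\<Union>c\<in>?F. S c)))" using closed by (simp add: closed_map_def)
  then have o1: "openin Y (topspace Y - e ` (topspace C - (\<Union>c\<in>?F. S c)))" by blast
  have o2: "y \<in> topspace Y - e ` (topspace C - (\<Union>c\<in>?F. S c))"
    using S y chart(2)[OF lcs V] by blast
  obtain W where W: "openin Y W" "convex_subset V K W" "y \<in> W"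
      "W \<subseteq> topspace Y - e ` (topspace C - (\<Union>c\<in>?F. S c))" "(W, restrict K (W \<times> W)) \<in> \<V>"
    by (rule chart_convex_nbhd[OF lcs V o1 o2 y])
  let ?P = "{t \<in> topspace C. e t \<in> W}"
  have opP: "openin C ?P" using openin_continuous_map_preimage[OF cont W(1)] .
  have cover: "?P \<subseteq> (\<Union>c\<in>?F. S c)" using W(4) by blast
  have disj: "c = c'" if "c \<in> ?F" "c' \<in> ?F" "t \<in> S c" "t \<in> S c'" for c c' t
    by (rule sheets_disjoint[OF lcs C V, of e "S c" "S c'" _ _ t]) (use S that in auto)
  have closed_Un: "closedin (subtopology Y W) (\<Union>c\<in>?F. Q c)"
    if Q: "\<And>c. c \<in> topspace C \<Longrightarrow> e c = y \<Longrightarrow> closedin (subtopology Y (e ` S c \<inter> W)) (Q c)" for Q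
  proof -
    \<comment> \<open>The lifts of the sets \<open>Q c\<close> to their sheets. Their union is
      closed over \<open>W\<close>, and \<open>e\<close> restricted to the preimage of
      \<open>W\<close> is still a closed map.\<close>
    define D where "D c = {t \<in> S c. e t \<in> Q c}" for c
    have QW: "Q c \<subseteq> e ` S c \<inter> W" if "c \<in> ?F" for c
      using closedin_subset[OF Q[of c]] that by auto
    have SC: "S c \<subseteq> topspace C" if "c \<in> ?F" for c using S[of c] sheetD(3) that by blast
    have opD: "openin C (S c \<inter> ?P - D c)" if c: "c \<in> ?F" for c
    proof -
      obtain T where T: "closedin Y T" "Q c = T \<inter> (e ` S c \<inter> W)"
        using Q[of c] c unfolding closedin_subtopology by blast
      have eq: "S c \<inter> ?P - D c = S c \<inter> ?P \<inter> {t \<in> topspace C. e t \<in> topspace Y - T}"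
        using T(2) SC[OF c] continuous_map_image_subset_topspace[OF cont] unfolding D_def by auto
      have opT: "openin C {t \<in> topspace C. e t \<in> topspace Y - T}"
        using T(1) by (intro openin_continuous_map_preimage[OF cont]) blast
      have opS: "openin C (S c)" using S[of c] c sheetD(1) by blast
      show ?thesis unfolding eq by (intro openin_Int opS opP opT)
    qed
    \<comment> \<open>Disjointness of the sheets: a point of \<open>S c\<close> outside
      \<open>D c\<close> belongs to no other lift, so the complement of all lifts is a union of open
      sets.\<close>
    have eq: "?P - (\<Union>c\<in>?F. D c) = (\<Union>c\<in>?F. S c \<inter> ?P - D c)"
    proof (rule subset_antisym)
      show "?P - (\<Union>c\<in>?F. D c) \<subseteq> (\<Union>c\<in>?F. S c \<inter> ?P - D c)" using cover by blast
      show "(\<Union>c\<in>?F. S c \<inter> ?P - D c) \<subseteq> ?P - (\<Union>c\<in>?F. D c)"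
      proof
        fix t assume "t \<in> (\<Union>c\<in>?F. S c \<inter> ?P - D c)"
        then obtain c where c: "c \<in> ?F" "t \<in> S c" "t \<in> ?P" "t \<notin> D c" by blast
        have "t \<notin> D c'" if "c' \<in> ?F" for c'
          using disj[OF c(1) that c(2)] c(4) by (auto simp: D_def)
        then show "t \<in> ?P - (\<Union>c\<in>?F. D c)" using c(3) by blast
      qed
    qed
    have "openin C (?P - (\<Union>c\<in>?F. D c))" unfolding eq using opD by blast
    then have "openin (subtopology C ?P) (?P - (\<Union>c\<in>?F. D c))"
      unfolding openin_open_subtopology[OF opP] by blast
    moreover have tP: "topspace (subtopology C ?P) = ?P"
      by (rule topspace_subtopology_subset[OF openin_subset[OF opP]])
    moreover have "(\<Union>c\<in>?F. D c) \<subseteq> ?P" using QW SC unfolding D_def by blast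
    ultimately have "closedin (subtopology C ?P) (\<Union>c\<in>?F. D c)"
      unfolding closedin_def tP by (intro conjI)
    then have "closedin (subtopology Y W) (e ` (\<Union>c\<in>?F. D c))"
      using closed_map_restriction[OF closed, of W ?P] by (simp add: closed_map_def)
    moreover have "e ` (\<Union>c\<in>?F. D c) = (\<Union>c\<in>?F. Q c)" using QW unfolding D_def by blast
    ultimately show ?thesis by simp
  qed
  show thesis by (rule that[OF W(1-3,5)], intro allI impI, rule closed_Un) simp
qed

section \<open>Finiteness of fibres\<close>

lemma infinite_sets_distinct_choice:
  fixes A :: "nat \<Rightarrow> 'a set"
  assumes "\<And>n. infinite (A n)"
  obtains r where "inj r" "\<And>n. r n \<in> A n"
proof -
  have "\<exists>r. \<forall>n. r n \<in> A n \<and> r n \<notin> r ` {..<n}"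
  proof (rule dependent_wellorder_choice)
    fix r :: 'a and f g :: "nat \<Rightarrow> 'a" and n
    assume "\<And>m. m < n \<Longrightarrow> f m = g m"
    then have "f ` {..<n} = g ` {..<n}" by auto
    then show "(r \<in> A n \<and> r \<notin> f ` {..<n}) = (r \<in> A n \<and> r \<notin> g ` {..<n})" by simp
  next
    fix n and f :: "nat \<Rightarrow> 'a"
    have "infinite (A n - f ` {..<n})" using assms by (simp add: Diff_infinite_finite)
    then show "\<exists>r. r \<in> A n \<and> r \<notin> f ` {..<n}" by (metis Diff_iff ex_in_conv finite.emptyI)
  qed
  then obtain r where r: "\<And>n. r n \<in> A n" "\<And>n. r n \<notin> r ` {..<n}" by blast
  have "inj r"
  proof (rule linorder_injI)
    fix m n :: nat assume "m < n"
    then have "r m \<in> r ` {..<n}" by simp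
    then show "r m \<noteq> r n" using r(2)[of n] by metis
  qed
  then show thesis using r(1) that by blast
qed

text \<open>An infinite fibre contains infinitely many points such that the chosen segments issuing from
  \<open>y\<close>, one in each sheet, either pairwise meet only in \<open>y\<close> or all meet a fixed one outside \<open>y\<close>. In
  the first case the segments form a closed star. In the second case they contain the distinct terms
  of a sequence in the fixed compact segment all of whose subsequences have closed range.\<close>

lemma etale_finite_fibre:
  assumes Yq: "geodesic_q_manifold Y \<V>" and e: "etale_map C Y \<V> e"
  shows "finite {c \<in> topspace C. e c = y}" (is "finite ?F")
proof (rule ccontr)
  assume inf: "infinite ?F"
  have Y: "geodesic_manifold Y \<V>" and sf: "\<And>V K. (V, K) \<in> \<V> \<Longrightarrow> star_finite (subtopology Y V) K"
    using Yq by (auto simp: geodesic_q_manifold_def)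
  have lcs: "local_convexity_structure Y \<V>" using Y by (simp add: geodesic_manifold_def)
  have C: "Hausdorff_space C" and conn: "connected_space C" and cont: "continuous_map C Y e"
    using e by (simp_all add: etale_map_def)
  obtain c0 where "c0 \<in> ?F" using inf by (metis finite.emptyI ex_in_conv)
  then have "y \<in> topspace Y" using continuous_map_image_subset_topspace[OF cont] by blast
  then have "y \<in> \<Union>(fst ` \<V>)" using lcs by (simp add: local_convexity_structure_def)
  then obtain V K where V: "(V, K) \<in> \<V>" and y: "y \<in> V" by auto
  have "\<exists>U. c \<in> U \<and> sheet C Y e U \<and> convex_subset V K (e ` U)"
    if c: "c \<in> topspace C" "e c = y" for c
  proof -
    have "e c \<in> V" using c(2) y by simp
    then obtain U where "c \<in> U" "sheet C Y e U" "convex_subset V K (e ` U)"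
      by (rule etale_sheet[OF Y e V c(1)])
    then show ?thesis by blast
  qed
  then obtain S where S: "\<And>c. c \<in> topspace C \<Longrightarrow> e c = y \<Longrightarrow>
      c \<in> S c \<and> sheet C Y e (S c) \<and> convex_subset V K (e ` S c)"
    by metis
  obtain W where W: "openin Y W" "convex_subset V K W" "y \<in> W" "(W, restrict K (W \<times> W)) \<in> \<V>"
    and closed_Un: "\<forall>Q. (\<forall>c\<in>?F. closedin (subtopology Y (e ` S c \<inter> W)) (Q c)) \<longrightarrow>
      closedin (subtopology Y W) (\<Union>c\<in>?F. Q c)"
    by (rule etale_evenly_covered[OF lcs e V y, of S]) (rule S)
  define k where "k = restrict K (W \<times> W)"
  have kW: "(W, k) \<in> \<V>" using W(4) by (simp add: k_def)
  let ?X = "subtopology Y W"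
  note cs = chart(3)[OF lcs kW] and tX = chart(4)[OF lcs kW]
  note seg = chart_segment[OF lcs kW]
  define G where "G c = e ` S c \<inter> W" for c
  have closed_G: "closedin ?X (\<Union>c\<in>?F. Q c)"
    if Q: "\<And>c. c \<in> ?F \<Longrightarrow> closedin ?X (Q c) \<and> Q c \<subseteq> G c" for Q
  proof (rule closed_Un[rule_format])
    fix c assume "c \<in> ?F"
    then have "closedin (subtopology ?X (G c)) (Q c)"
      using Q closedin_subset_topspace[of ?X "Q c" "G c"] by blast
    moreover have "W \<inter> G c = G c" by (auto simp: G_def)
    ultimately show "closedin (subtopology Y (e ` S c \<inter> W)) (Q c)"
      by (simp add: subtopology_subtopology G_def)
  qed
  have Gconv: "k (a, b) \<subseteq> G c" if c: "c \<in> ?F" and ab: "a \<in> G c" "b \<in> G c" for a b c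
  proof -
    have "k (a, b) = K (a, b)" using ab by (simp add: k_def G_def)
    moreover have "K (a, b) \<subseteq> W" using convex_subsetD(2)[OF W(2)] ab by (simp add: G_def)
    moreover have "K (a, b) \<subseteq> e ` S c"
      using convex_subsetD(2)[of V K "e ` S c"] S[of c] c ab by (simp add: G_def)
    ultimately show ?thesis by (simp add: G_def)
  qed
  have yG: "y \<in> G c" if "c \<in> ?F" for c using S[of c] W(3) that by (auto simp: G_def)
  \<comment> \<open>Otherwise \<open>{c}\<close> is open, being the part of its sheet over
    \<open>W\<close>. Connectedness of \<open>C\<close> then gives \<open>C = {c}\<close>, although
    the fibre is infinite.\<close>
  have "\<exists>z. z \<in> G c \<and> z \<noteq> y" if c: "c \<in> ?F" for c
  proof (rule ccontr)
    assume *: "\<not> ?thesis"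
    have Sc: "c \<in> S c" "sheet C Y e (S c)" using S[of c] c by simp_all
    let ?P = "S c \<inter> {t \<in> topspace C. e t \<in> W}"
    have "openin C ?P" using sheetD(1)[OF Sc(2)] openin_continuous_map_preimage[OF cont W(1)] by blast
    moreover have "?P = {c}"
    proof
      have "t = c" if "t \<in> ?P" for t
      proof -
        have "e t = e c" using * that c by (auto simp: G_def)
        then show ?thesis using sheetD(5)[OF Sc(2)] Sc(1) that by (auto simp: inj_on_def)
      qed
      then show "?P \<subseteq> {c}" by blast
      show "{c} \<subseteq> ?P" using Sc(1) c W(3) by simp
    qed
    moreover have "closedin C {c}" using C c by (simp add: closedin_Hausdorff_singleton)
    ultimately have "{c} = topspace C" using conn unfolding connected_space_clopen_in by auto
    then have "?F \<subseteq> {c}" by blast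
    then show False using inf finite_subset by blast
  qed
  then obtain z where z: "\<And>c. c \<in> ?F \<Longrightarrow> z c \<in> G c" "\<And>c. c \<in> ?F \<Longrightarrow> z c \<noteq> y" by metis
  have GW: "G c \<subseteq> W" for c by (simp add: G_def)
  have zW: "z c \<in> W" if "c \<in> ?F" for c using z(1)[OF that] GW by blast
  have kG: "k (y, z c) \<subseteq> G c" if "c \<in> ?F" for c using Gconv[OF that yG[OF that] z(1)[OF that]] .
  define meets where "meets c d \<longleftrightarrow> k (y, z c) \<inter> k (y, z d) \<noteq> {y}" for c d
  have meets_sym: "meets c d \<longleftrightarrow> meets d c" for c d by (simp add: meets_def Int_commute)
  \<comment> \<open>A colouring of pairs with two colours, in the form that \<open>Ramsey2\<close>
    expects.\<close>
  define f where "f P = (if \<exists>c d. P = {c, d} \<and> meets c d then 1 else 0 :: nat)" for P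
  have f: "f {c, d} = (if meets c d then 1 else 0)" for c d
    using meets_sym unfolding f_def by (auto simp: doubleton_eq_iff)
  have "\<forall>c\<in>?F. \<forall>d\<in>?F. c \<noteq> d \<longrightarrow> f {c, d} < 2" by (simp add: f)
  from Ramsey2[OF inf this] obtain F1 t where F1: "F1 \<subseteq> ?F" "infinite F1"
      and "\<forall>c\<in>F1. \<forall>d\<in>F1. c \<noteq> d \<longrightarrow> f {c, d} = t"
    by (elim exE conjE)
  then have t: "f {c, d} = t" if "c \<in> F1" "d \<in> F1" "c \<noteq> d" for c d using that by simp
  show False
  proof (cases "t = 0")
    case True
    have disj: "k (y, z c) \<inter> k (y, z d) = {y}" if "c \<in> F1" "d \<in> F1" "c \<noteq> d" for c d
    proof -
      have "\<not> meets c d" using t[OF that] True by (auto simp: f split: if_splits)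
      then show ?thesis by (simp add: meets_def)
    qed
    have "inj_on z F1"
    proof (rule inj_onI, rule ccontr)
      fix c d assume cd: "c \<in> F1" "d \<in> F1" "z c = z d" "c \<noteq> d"
      have cF: "c \<in> ?F" using cd(1) F1(1) by blast
      have "z c \<in> k (y, z c)" using seg(3)[OF W(3) zW[OF cF]] .
      then show False using disj[OF cd(1,2,4)] cd(3) z(2)[OF cF] by auto
    qed
    then have "infinite (z ` F1)" using F1(2) finite_imageD by blast
    moreover have "is_star ?X k y (z ` F1) \<and> closedin ?X (star_set k y (z ` F1))"
      unfolding closed_star_iff[OF cs] tX
    proof (intro conjI allI impI)
      show "y \<in> W" using W(3) .
      show "z ` F1 \<subseteq> W - {y}" using zW z(2) F1(1) by blast
      show "\<forall>a\<in>z ` F1. \<forall>b\<in>z ` F1. a \<noteq> b \<longrightarrow> k (y, a) \<inter> k (y, b) = {y}"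
        using disj by blast
      fix A assume A: "A \<subseteq> star_set k y (z ` F1) \<and> (\<forall>a\<in>z ` F1. closedin ?X (A \<inter> k (y, a)))"
      \<comment> \<open>Cutting \<open>A\<close> into its traces on the arms puts one closed piece
        into each sheet image, so the closed union property is exactly the star criterion.\<close>
      define Q where "Q c = (if c \<in> F1 then A \<inter> k (y, z c) else {})" for c
      have "closedin ?X (\<Union>c\<in>?F. Q c)"
      proof (rule closed_G)
        fix c assume "c \<in> ?F"
        then show "closedin ?X (Q c) \<and> Q c \<subseteq> G c" using A kG[of c] by (auto simp: Q_def)
      qed
      moreover have "(\<Union>c\<in>?F. Q c) = A"
      proof
        show "(\<Union>c\<in>?F. Q c) \<subseteq> A" by (auto simp: Q_def)
        show "A \<subseteq> (\<Union>c\<in>?F. Q c)"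
        proof
          fix a assume a: "a \<in> A"
          then obtain c where c: "c \<in> F1" "a \<in> k (y, z c)" using A by (auto simp: star_set_def)
          then have "a \<in> Q c" using a by (simp add: Q_def)
          then show "a \<in> (\<Union>c\<in>?F. Q c)" using c(1) F1(1) by blast
        qed
      qed
      ultimately show "closedin ?X A" by simp
    qed
    ultimately show False using sf[OF kW] unfolding star_finite_def by blast
  next
    case False
    obtain c1 where c1: "c1 \<in> F1" using F1(2) by (metis finite.emptyI ex_in_conv)
    have c1F: "c1 \<in> ?F" using c1 F1(1) by blast
    have "infinite (F1 - {c1})" using F1(2) by simp
    then obtain s :: "nat \<Rightarrow> _" where s: "inj s" "range s \<subseteq> F1 - {c1}"
      using infinite_countable_subset by blast
    have sF: "s n \<in> ?F" for n using s(2) F1(1) by blast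
    have "\<exists>p. p \<in> k (y, z (s n)) \<and> p \<in> k (y, z c1) \<and> p \<noteq> y" for n
    proof -
      have "s n \<in> F1" "s n \<noteq> c1" using s(2) by auto
      then have "meets (s n) c1" using t[of "s n" c1] c1 False by (auto simp: f split: if_splits)
      moreover have "y \<in> k (y, z (s n)) \<inter> k (y, z c1)"
        using seg(2)[OF W(3) zW] sF c1F by blast
      ultimately show ?thesis unfolding meets_def by blast
    qed
    then obtain p where p: "\<And>n. p n \<in> k (y, z (s n))" "\<And>n. p n \<in> k (y, z c1)" "\<And>n. p n \<noteq> y"
      by metis
    have pW: "p n \<in> W" for n using p(2)[of n] seg(4)[OF W(3) zW[OF c1F]] by blast
    \<comment> \<open>The common points \<open>p n\<close> may coincide. All of
      \<open>k (y, p n)\<close> is common to both segments and infinite, which leaves room to choose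
      distinct points \<open>r n\<close>.\<close>
    have "infinite (k (y, p n))" for n
      using segment_not_isolated[OF cs, unfolded tX, OF W(3) pW _ _ W(3), of n] p(3)[of n]
        openin_topspace[of ?X, unfolded tX] infinite_super by (metis inf_le1)
    then obtain r where r: "inj r" "\<And>n. r n \<in> k (y, p n)"
      using infinite_sets_distinct_choice[of "\<lambda>n. k (y, p n)"] by blast
    have sub: "k (y, p n) \<subseteq> k (y, z c)" if "p n \<in> k (y, z c)" "c \<in> ?F" for n c
      using segment_mono[OF cs, unfolded tX, OF W(3) zW[OF that(2)] _ that(1)]
        seg(2)[OF W(3) zW[OF that(2)]] .
    have rJ: "r n \<in> k (y, z c1)" for n using sub[OF p(2) c1F] r(2) by blast
    have rG: "r n \<in> G (s n)" for n using sub[OF p(1) sF] kG[OF sF] r(2) by blast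
    have "infinite (range r)" using r(1) range_inj_infinite by blast
    moreover have "compactin ?X (k (y, z c1))"
      using compactin_segment[OF cs, unfolded tX, OF W(3) zW[OF c1F]] .
    ultimately obtain w where w: "w \<in> ?X derived_set_of (range r)"
      using compactin_imp_Bolzano_Weierstrass[of ?X "k (y, z c1)" "range r"] rJ by blast
    \<comment> \<open>Each sheet image receives at most one point, as \<open>s\<close> is injective,
      so the range of \<open>r\<close> without \<open>w\<close> is closed. Its complement is then a
      neighbourhood of the accumulation point \<open>w\<close> that meets the range at most in
      \<open>w\<close>.\<close>
    define Q where "Q c = {r n | n. c = s n \<and> r n \<noteq> w}" for c
    have "closedin ?X (\<Union>c\<in>?F. Q c)"
    proof (rule closed_G)
      fix c assume "c \<in> ?F"
      show "closedin ?X (Q c) \<and> Q c \<subseteq> G c"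
      proof
        show QG: "Q c \<subseteq> G c" using rG by (auto simp: Q_def)
        have "Q c \<subseteq> r ` (s -` {c})" by (auto simp: Q_def)
        moreover have "finite (s -` {c})" using s(1) by (simp add: finite_vimageI)
        ultimately have fin: "finite (Q c)" by (meson finite_imageI finite_subset)
        have "Q c \<subseteq> topspace ?X" unfolding tX using QG GW by (rule subset_trans)
        then show "closedin ?X (Q c)" using fin by (rule closedin_Hausdorff_finite[OF convexity_space_Hausdorff[OF cs]])
      qed
    qed
    moreover have "(\<Union>c\<in>?F. Q c) = range r - {w}"
      using sF unfolding Q_def by blast
    ultimately have op: "openin ?X (topspace ?X - (range r - {w}))"
      by (intro openin_diff openin_topspace) simp
    have "w \<in> topspace ?X - (range r - {w})" using w by (simp add: in_derived_set_of)
    from w[unfolded in_derived_set_of, THEN conjunct2, rule_format, OF conjI[OF this op]]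
    show False by blast
  qed
qed

section \<open>Composition of etale maps and the induced atlas\<close>

lemma sheet_compose:
  assumes W: "sheet D C g W" and U: "sheet C Y e U" and sub: "g ` W \<subseteq> U"
  shows "sheet D Y (e \<circ> g) W"
  unfolding sheet_def
proof
  show "openin D W" using sheetD(1)[OF W] .
  have "homeomorphic_map (subtopology (subtopology C U) (g ` W)) (subtopology (subtopology Y (e ` U)) (e ` g ` W)) e"
  proof (rule homeomorphic_map_subtopologies[OF sheetD(2)[OF U]])
    have "e ` U \<subseteq> topspace Y" using sheetD(6)[OF U] .
    then have "topspace (subtopology Y (e ` U)) = e ` U" by (rule topspace_subtopology_subset)
    then show "e ` (topspace (subtopology C U) \<inter> g ` W) = topspace (subtopology Y (e ` U)) \<inter> e ` g ` W"
      using sub sheetD(4)[OF U] by blast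
  qed
  moreover have "U \<inter> g ` W = g ` W" "e ` U \<inter> e ` g ` W = e ` g ` W" using sub by blast+
  ultimately have "homeomorphic_map (subtopology C (g ` W)) (subtopology Y (e ` g ` W)) e"
    by (simp only: subtopology_subtopology)
  from homeomorphic_map_compose[OF sheetD(2)[OF W] this]
  show "homeomorphic_map (subtopology D W) (subtopology Y ((e \<circ> g) ` W)) (e \<circ> g)"
    by (simp only: image_comp)
qed

lemma fst_induced_atlas_sheet:
  "U \<in> fst ` induced_atlas C Y \<V> e \<longleftrightarrow>
     (\<exists>V K. (V, K) \<in> \<V> \<and> sheet C Y e U \<and> convex_subset V K (e ` U))"
  unfolding fst_induced_atlas sheet_def by blast

context
  fixes Y :: "'a topology" and \<V> :: "'a atlas"
  assumes lcs: "local_convexity_structure Y \<V>"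
begin

lemma convexity_space_induced_atlas:
  assumes "(U, k) \<in> induced_atlas C Y \<V> e"
  shows "convexity_space (subtopology C U) k"
proof -
  obtain V K where V: "(V, K) \<in> \<V>" and U: "sheet C Y e U" "convex_subset V K (e ` U)"
      and k: "k = restrict (\<lambda>(x, y). {z \<in> U. e z \<in> K (e x, e y)}) (U \<times> U)"
    using assms unfolding induced_atlas_iff by blast
  have "V \<inter> e ` U = e ` U" using convex_subsetD(1)[OF U(2)] by blast
  then have "subtopology (subtopology Y V) (e ` U) = subtopology Y (e ` U)"
    by (simp only: subtopology_subtopology)
  then show ?thesis
    using convexity_space_pullback[OF chart(3)[OF lcs V], of "subtopology C U" e] U(2) sheetD(2)[OF U(1)]
    unfolding sheetD(4)[OF U(1)] chart(4)[OF lcs V] k by simp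
qed

lemma local_convexity_structure_induced_atlas:
  assumes e: "etale_map C Y \<V> e"
  shows "local_convexity_structure C (induced_atlas C Y \<V> e)"
proof -
  have "openin C U \<and> convexity_space (subtopology C U) k \<and>
      (\<forall>W. openin (subtopology C U) W \<and> convex_subset U k W \<longrightarrow>
        (W, restrict k (W \<times> W)) \<in> induced_atlas C Y \<V> e)"
    if Uk: "(U, k) \<in> induced_atlas C Y \<V> e" for U k
  proof (intro conjI allI impI)
    obtain V K where V: "(V, K) \<in> \<V>" and U: "sheet C Y e U" "convex_subset V K (e ` U)"
      and k: "k = restrict (\<lambda>(x, y). {z \<in> U. e z \<in> K (e x, e y)}) (U \<times> U)"
      using Uk unfolding induced_atlas_iff by blast
    show "openin C U" using sheetD(1)[OF U(1)] .
    show "convexity_space (subtopology C U) k" using convexity_space_induced_atlas[OF Uk] .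
    fix W assume W: "openin (subtopology C U) W \<and> convex_subset U k W"
    then have WU: "W \<subseteq> U" "openin C W"
      using openin_open_subtopology[OF sheetD(1)[OF U(1)]] by blast+
    \<comment> \<open>Lifts to \<open>U\<close> of segments between points of \<open>e\<close>
      W\<open>stay in\<close>W\<open>. This yields both the convexity of\<close>e \<open>W\<close>
      and the equality of the restricted map with the one that the induced atlas assigns to
      \<open>W\<close>.\<close>
    have kW: "{z \<in> U. e z \<in> K (e a, e b)} \<subseteq> W" if "a \<in> W" "b \<in> W" for a b
    proof -
      have "k (a, b) \<subseteq> W" using convex_subsetD(2)[of U k W] W that by blast
      moreover have "k (a, b) = {z \<in> U. e z \<in> K (e a, e b)}" using that WU(1) by (auto simp: k)
      ultimately show ?thesis by simp
    qed
    have "sheet C Y e W" using sheet_Int[OF U(1) WU(2)] WU(1) by (simp add: Int_absorb1)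
    moreover have "convex_subset V K (e ` W)"
      unfolding convex_subset_def
    proof (intro conjI ballI)
      show "e ` W \<subseteq> V" using convex_subsetD(1)[OF U(2)] WU(1) by blast
      fix p q assume "p \<in> e ` W" "q \<in> e ` W"
      then obtain a b where ab: "a \<in> W" "b \<in> W" "p = e a" "q = e b" by blast
      then have "K (p, q) \<subseteq> e ` U" using convex_subsetD(2)[OF U(2), of p q] WU(1) by blast
      then show "K (p, q) \<subseteq> e ` W" using kW[OF ab(1,2)] ab(3,4) by blast
    qed
    moreover have "restrict k (W \<times> W) = restrict (\<lambda>(x, y). {z \<in> W. e z \<in> K (e x, e y)}) (W \<times> W)"
    proof (rule restrict_ext)
      fix p assume "p \<in> W \<times> W"
      then obtain a b where "p = (a, b)" "a \<in> W" "b \<in> W" by blast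
      then show "k p = (\<lambda>(x, y). {z \<in> W. e z \<in> K (e x, e y)}) p"
        using kW[of a b] WU(1) by (auto simp: k)
    qed
    ultimately show "(W, restrict k (W \<times> W)) \<in> induced_atlas C Y \<V> e"
      unfolding induced_atlas_iff using V by blast
  qed
  then show ?thesis
    using e unfolding local_convexity_structure_def etale_map_def by blast
qed

text \<open>\<open>hull\<close> is an intersection of sets. For
  \<open>A \<subseteq> topspace Y\<close> the whole space is one of them; an intersection over the
  empty family would be the entire type.\<close>

lemma locally_convex_subset_hull:
  assumes "A \<subseteq> topspace Y"
  shows "locally_convex_subset Y \<V> (local_convex_hull Y \<V> A)"
proof -
  let ?H = "local_convex_hull Y \<V> A"
  have "convex_subset V K (topspace Y \<inter> V)" if V: "(V, K) \<in> \<V>" for V K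
    using chart(2)[OF lcs V] chart_segment(4)[OF lcs V] unfolding convex_subset_def by blast
  then have "locally_convex_subset Y \<V> (topspace Y)"
    unfolding locally_convex_subset_def by blast
  then have "?H \<subseteq> topspace Y"
    unfolding local_convex_hull_def using assms by (rule hull_minimal[rotated])
  moreover have "convex_subset V K (?H \<inter> V)" if V: "(V, K) \<in> \<V>" for V K
  proof -
    have "K (p, q) \<subseteq> ?H \<inter> V" if pq: "p \<in> ?H \<inter> V" "q \<in> ?H \<inter> V" for p q
    proof -
      have "K (p, q) \<subseteq> S" if S: "locally_convex_subset Y \<V> S" "A \<subseteq> S" for S
      proof -
        have "?H \<subseteq> S" unfolding local_convex_hull_def using S(2,1) by (rule hull_minimal)
        moreover have "convex_subset V K (S \<inter> V)"
          using S(1) V by (auto simp: locally_convex_subset_def)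
        ultimately show ?thesis using convex_subsetD(2)[of V K "S \<inter> V" p q] pq by blast
      qed
      then have "K (p, q) \<subseteq> ?H" unfolding local_convex_hull_def hull_def by blast
      then show ?thesis using chart_segment(4)[OF lcs V] pq by blast
    qed
    then show ?thesis unfolding convex_subset_def by blast
  qed
  ultimately show ?thesis unfolding locally_convex_subset_def by blast
qed

text \<open>Segments of \<open>C\<close> lie over segments of \<open>Y\<close>. This bounds the hull
  of a set by the preimage of the hull of its image, which is what (G1) for \<open>C\<close>
  needs.\<close>

lemma locally_convex_subset_preimage:
  assumes e: "etale_map C Y \<V> e" and A: "locally_convex_subset Y \<V> A"
  shows "locally_convex_subset C (induced_atlas C Y \<V> e) {c \<in> topspace C. e c \<in> A}"
proof -
  have "convex_subset U k ({c \<in> topspace C. e c \<in> A} \<inter> U)"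
    if Uk: "(U, k) \<in> induced_atlas C Y \<V> e" for U k
  proof -
    obtain V K where V: "(V, K) \<in> \<V>" and U: "sheet C Y e U" "convex_subset V K (e ` U)"
      and k: "k = restrict (\<lambda>(x, y). {z \<in> U. e z \<in> K (e x, e y)}) (U \<times> U)"
      using Uk unfolding induced_atlas_iff by blast
    have "convex_subset V K (A \<inter> V)" using A V by (auto simp: locally_convex_subset_def)
    note AV = convex_subsetD(2)[OF this] and eU = convex_subsetD(1)[OF U(2)]
    have "k (a, b) \<subseteq> {c \<in> topspace C. e c \<in> A} \<inter> U"
      if "a \<in> {c \<in> topspace C. e c \<in> A} \<inter> U" "b \<in> {c \<in> topspace C. e c \<in> A} \<inter> U" for a b
    proof -
      have "K (e a, e b) \<subseteq> A \<inter> V" using that eU by (intro AV) auto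
      moreover have "k (a, b) = {z \<in> U. e z \<in> K (e a, e b)}" using that by (simp add: k)
      ultimately show ?thesis using sheetD(3)[OF U(1)] by blast
    qed
    then show ?thesis unfolding convex_subset_def by blast
  qed
  then show ?thesis unfolding locally_convex_subset_def by blast
qed

text \<open>A segment of \<open>V\<close> between points of \<open>e\<close> g \<open>W\<close>
  lifts to \<open>U\<close>, as \<open>e\<close> U\<open>is convex, and the lift stays in\<close>g
  \<open>W\<close>, as this set is convex in \<open>U\<close>. So the image of \<open>W\<close>
  under the composite is convex in \<open>V\<close>.\<close>

lemma fst_induced_atlas_trans:
  assumes "W \<in> fst ` induced_atlas D C (induced_atlas C Y \<V> e) g"
  obtains U V K where "sheet D C g W" "(V, K) \<in> \<V>" "sheet C Y e U" "convex_subset V K (e ` U)"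
    "g ` W \<subseteq> U" "W \<in> fst ` induced_atlas D Y \<V> (e \<circ> g)"
proof -
  obtain U k where Uk: "(U, k) \<in> induced_atlas C Y \<V> e" and W: "sheet D C g W" "convex_subset U k (g ` W)"
    using assms unfolding fst_induced_atlas_sheet by blast
  obtain V K where V: "(V, K) \<in> \<V>" and U: "sheet C Y e U" "convex_subset V K (e ` U)"
      and k: "k = restrict (\<lambda>(x, y). {z \<in> U. e z \<in> K (e x, e y)}) (U \<times> U)"
    using Uk unfolding induced_atlas_iff by blast
  note WU = convex_subsetD(1)[OF W(2)]
  have "convex_subset V K ((e \<circ> g) ` W)"
    unfolding convex_subset_def
  proof (intro conjI ballI)
    show "(e \<circ> g) ` W \<subseteq> V" using convex_subsetD(1)[OF U(2)] WU by auto
    fix p q assume "p \<in> (e \<circ> g) ` W" "q \<in> (e \<circ> g) ` W"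
    then obtain a b where ab: "a \<in> g ` W" "b \<in> g ` W" "p = e a" "q = e b" by auto
    then have "K (p, q) \<subseteq> e ` U" using convex_subsetD(2)[OF U(2), of p q] WU by blast
    moreover have "{z \<in> U. e z \<in> K (p, q)} \<subseteq> g ` W"
    proof -
      have "k (a, b) = {z \<in> U. e z \<in> K (p, q)}" using ab WU by (auto simp: k)
      then show ?thesis using convex_subsetD(2)[OF W(2) ab(1,2)] by simp
    qed
    ultimately show "K (p, q) \<subseteq> (e \<circ> g) ` W" unfolding image_comp[symmetric] by blast
  qed
  then have "W \<in> fst ` induced_atlas D Y \<V> (e \<circ> g)"
    unfolding fst_induced_atlas_sheet using V sheet_compose[OF W(1) U(1) WU] by blast
  then show thesis by (rule that[OF W(1) V U WU])
qed

lemma etale_map_trans: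
  assumes e: "etale_map C Y \<V> e" and g: "etale_map D C (induced_atlas C Y \<V> e) g"
  shows "etale_map D Y \<V> (e \<circ> g)"
proof -
  let ?A = "fst ` induced_atlas D C (induced_atlas C Y \<V> e) g"
  let ?B = "fst ` induced_atlas D Y \<V> (e \<circ> g)"
  have "?A \<subseteq> ?B" using fst_induced_atlas_trans by blast
  then have "\<Union>?A \<subseteq> \<Union>?B" by blast
  moreover have "\<Union>?A = topspace D" using g by (simp add: etale_map_def)
  moreover have "\<Union>?B \<subseteq> topspace D" unfolding fst_induced_atlas using openin_subset by blast
  moreover have "continuous_map D Y (e \<circ> g)" "closed_map D Y (e \<circ> g)"
    using e g continuous_map_compose[of D C g Y e] closed_map_compose[of D C g Y e]
    by (simp_all add: etale_map_def)
  ultimately show ?thesis using g unfolding etale_map_def by blast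
qed

text \<open>For \<open>p, q\<close> in a chart \<open>U\<close> and in a sheet \<open>U'\<close> of \<open>C\<close>, the segment of \<open>U\<close> from \<open>p\<close> to \<open>q\<close>
  lies in \<open>U'\<close> by unique lifting, provided that \<open>e ` U'\<close> contains its image.\<close>

lemma etale_generated_by_trans:
  assumes e: "etale_map C Y \<V> e" and g: "etale_map D C (induced_atlas C Y \<V> e) g"
    and gen: "etale_generated_by D C (induced_atlas C Y \<V> e) g F"
  shows "etale_generated_by D Y \<V> (e \<circ> g) F"
proof -
  have C: "Hausdorff_space C" using e by (simp add: etale_map_def)
  \<comment> \<open>Contrapositive: a proper closed connected \<open>A\<close> showing that
    \<open>F\<close> does not generate the composite shows the same for \<open>g\<close>.\<close>
  have "locally_convex_subset C (induced_atlas C Y \<V> e) (g ` (W \<inter> A))"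
    if A: "\<forall>W\<in>fst ` induced_atlas D Y \<V> (e \<circ> g). locally_convex_subset Y \<V> ((e \<circ> g) ` (W \<inter> A))"
      and W: "W \<in> fst ` induced_atlas D C (induced_atlas C Y \<V> e) g" for W A
  proof -
    obtain U' where W': "sheet D C g W" "sheet C Y e U'" "g ` W \<subseteq> U'"
        "W \<in> fst ` induced_atlas D Y \<V> (e \<circ> g)"
      using fst_induced_atlas_trans[OF W] by metis
    have lc: "locally_convex_subset Y \<V> (e ` g ` (W \<inter> A))"
      using bspec[OF A W'(4)] by (simp only: image_comp)
    have "convex_subset U k (g ` (W \<inter> A) \<inter> U)" if Uk: "(U, k) \<in> induced_atlas C Y \<V> e" for U k
    proof -
      obtain V K where V: "(V, K) \<in> \<V>" and U: "sheet C Y e U" "convex_subset V K (e ` U)"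
          and k: "k = restrict (\<lambda>(x, y). {z \<in> U. e z \<in> K (e x, e y)}) (U \<times> U)"
        using Uk unfolding induced_atlas_iff by blast
      have "convex_subset V K (e ` g ` (W \<inter> A) \<inter> V)"
        using lc V by (auto simp: locally_convex_subset_def)
      note conv = convex_subsetD(2)[OF this]
      have "k (p, q) \<subseteq> g ` (W \<inter> A) \<inter> U"
        if pq: "p \<in> g ` (W \<inter> A) \<inter> U" "q \<in> g ` (W \<inter> A) \<inter> U" for p q
      proof
        fix t assume "t \<in> k (p, q)"
        then have t: "t \<in> U" "e t \<in> K (e p, e q)" using pq by (auto simp: k)
        let ?J = "K (e p, e q)"
        have pV: "e p \<in> V" "e q \<in> V" using pq convex_subsetD(1)[OF U(2)] by blast+
        note J = chart_segment[OF lcs V pV]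
        have JA: "?J \<subseteq> e ` g ` (W \<inter> A)"
          using conv[of "e p" "e q"] pq pV by blast
        have JU: "?J \<subseteq> e ` U" using convex_subsetD(2)[OF U(2), of "e p" "e q"] pq by blast
        have JU': "?J \<subseteq> e ` U'" using JA W'(3) by blast
        have pU: "p \<in> U" "p \<in> U'" using pq W'(3) by blast+
        have tU': "t \<in> U'"
          using sheet_lift_unique[OF C U(1) W'(2) J(1) JU JU' pU J(2) t] .
        obtain t' where t': "t' \<in> g ` (W \<inter> A)" "e t = e t'" using JA t(2) by blast
        then have "t' \<in> U'" using W'(3) by blast
        then have "t = t'" using sheetD(5)[OF W'(2)] tU' t'(2) by (simp add: inj_on_def)
        then show "t \<in> g ` (W \<inter> A) \<inter> U" using t' t(1) by blast
      qed
      then show ?thesis unfolding convex_subset_def by blast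
    qed
    moreover have "g ` (W \<inter> A) \<subseteq> topspace C" using W'(3) sheetD(3)[OF W'(2)] by blast
    ultimately show ?thesis unfolding locally_convex_subset_def by blast
  qed
  then show ?thesis using gen unfolding etale_generated_by_def by meson
qed

end

text \<open>The image of a closed star of \<open>U\<close> need not be closed in a chart, since
  \<open>e\<close>
  U\<open>need not be. Over a suitable\<close>W\<open>, however, relatively closed subsets of\<close>e
  \<open>U \<inter> W\<close> are closed in \<open>W\<close>. Shortening every arm until it maps
  into \<open>W\<close> therefore yields a closed star of the chart \<open>W\<close> with equally
  many ends.\<close>

lemma etale_star_finite:
  assumes Yq: "geodesic_q_manifold Y \<V>" and e: "etale_map C Y \<V> e"
    and Uk: "(U, k) \<in> induced_atlas C Y \<V> e"
  shows "star_finite (subtopology C U) k"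
  unfolding star_finite_def
proof (intro allI impI)
  fix x E
  let ?X = "subtopology C U"
  have Y: "geodesic_manifold Y \<V>" and sf: "\<And>V K. (V, K) \<in> \<V> \<Longrightarrow> star_finite (subtopology Y V) K"
    using Yq by (auto simp: geodesic_q_manifold_def)
  have lcs: "local_convexity_structure Y \<V>" and YH: "Hausdorff_space Y"
    using Y by (simp_all add: geodesic_manifold_def)
  have cont: "continuous_map C Y e" using e by (simp add: etale_map_def)
  obtain V K where V: "(V, K) \<in> \<V>" and U: "sheet C Y e U" "convex_subset V K (e ` U)"
      and k_def: "k = restrict (\<lambda>(x, y). {z \<in> U. e z \<in> K (e x, e y)}) (U \<times> U)"
    using Uk unfolding induced_atlas_iff by blast
  note csU = convexity_space_induced_atlas[OF lcs Uk] and tX = sheetD(4)[OF U(1)]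
  have injU: "a = b" if "e a = e b" "a \<in> U" "b \<in> U" for a b
    using sheetD(5)[OF U(1)] that by (simp add: inj_on_def)
  have k: "k (a, b) = {z \<in> U. e z \<in> K (e a, e b)}" if "a \<in> U" "b \<in> U" for a b
    using that by (simp add: k_def)
  have ek: "e ` k (a, b) = K (e a, e b)" if ab: "a \<in> U" "b \<in> U" for a b
  proof -
    have "K (e a, e b) \<subseteq> e ` U" using convex_subsetD(2)[OF U(2)] ab by blast
    then show ?thesis unfolding k[OF ab] by blast
  qed
  assume "is_star ?X k x E \<and> closedin ?X (star_set k x E)"
  then have star: "x \<in> U" "E \<subseteq> U - {x}"
      and disj: "\<And>z z'. z \<in> E \<Longrightarrow> z' \<in> E \<Longrightarrow> z \<noteq> z' \<Longrightarrow> k (x, z) \<inter> k (x, z') = {x}"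
      and fine: "\<And>A. A \<subseteq> star_set k x E \<Longrightarrow> (\<And>z. z \<in> E \<Longrightarrow> closedin ?X (A \<inter> k (x, z))) \<Longrightarrow> closedin ?X A"
    unfolding closed_star_iff[OF csU] tX by simp_all
  have xC: "x \<in> topspace C" using star(1) sheetD(3)[OF U(1)] by blast
  define y where "y = e x"
  have yV: "y \<in> V" using convex_subsetD(1)[OF U(2)] star(1) by (auto simp: y_def)
  have "\<exists>S. c \<in> S \<and> sheet C Y e S \<and> convex_subset V K (e ` S) \<and> (c = x \<longrightarrow> S = U)"
    if c: "c \<in> topspace C" "e c = y" for c
  proof (cases "c = x")
    case True
    then show ?thesis using U star(1) by blast
  next
    case False
    have "e c \<in> V" using c(2) yV by simp
    then obtain S where "c \<in> S" "sheet C Y e S" "convex_subset V K (e ` S)"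
      by (rule etale_sheet[OF Y e V c(1)])
    then show ?thesis using False by blast
  qed
  then obtain S where S': "\<And>c. c \<in> topspace C \<Longrightarrow> e c = y \<Longrightarrow>
      c \<in> S c \<and> sheet C Y e (S c) \<and> convex_subset V K (e ` S c) \<and> (c = x \<longrightarrow> S c = U)"
    by metis
  then have S: "c \<in> S c \<and> sheet C Y e (S c) \<and> convex_subset V K (e ` S c)"
    if "c \<in> topspace C" "e c = y" for c using that by simp
  have Sx: "S x = U" using S'[OF xC] by (simp add: y_def)
  obtain W where W: "openin Y W" "convex_subset V K W" "y \<in> W" "(W, restrict K (W \<times> W)) \<in> \<V>"
    and closed_Un: "\<forall>Q. (\<forall>c\<in>{c \<in> topspace C. e c = y}. closedin (subtopology Y (e ` S c \<inter> W)) (Q c)) \<longrightarrow>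
      closedin (subtopology Y W) (\<Union>c\<in>{c \<in> topspace C. e c = y}. Q c)"
    by (rule etale_evenly_covered[OF lcs e V yV, of S]) (rule S)
  define h where "h = restrict K (W \<times> W)"
  have hW: "(W, h) \<in> \<V>" using W(4) by (simp add: h_def)
  let ?Z = "subtopology Y W"
  note csW = chart(3)[OF lcs hW] and tZ = chart(4)[OF lcs hW]
  \<comment> \<open>The closed union property for the family that is \<open>A\<close> at
    \<open>x\<close> and empty at all other points of the fibre.\<close>
  have closed_in_sheet: "closedin ?Z A" if A: "closedin (subtopology Y (e ` U)) A" "A \<subseteq> W" for A
  proof -
    have AU: "A \<subseteq> e ` U" using closedin_subset[OF A(1)] by simp
    have "closedin (subtopology (subtopology Y (e ` U)) (e ` U \<inter> W)) A"
      using AU A(2) closedin_subset_topspace[OF A(1), of "e ` U \<inter> W"] by blast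
    then have "closedin (subtopology Y (e ` U \<inter> W)) A"
      by (simp add: subtopology_subtopology)
    then have "\<forall>c\<in>{c \<in> topspace C. e c = y}.
        closedin (subtopology Y (e ` S c \<inter> W)) (if c = x then A else {})"
      using Sx by simp
    from closed_Un[rule_format, OF this[rule_format]]
    have "closedin ?Z (\<Union>c\<in>{c \<in> topspace C. e c = y}. if c = x then A else {})" .
    moreover have "(\<Union>c\<in>{c \<in> topspace C. e c = y}. if c = x then A else {}) = A"
      using xC by (auto simp: y_def split: if_splits)
    ultimately show ?thesis by simp
  qed
  let ?P = "{t \<in> topspace C. e t \<in> W}"
  have o1: "openin ?X (?P \<inter> U)"
    using openin_continuous_map_preimage[OF cont W(1)] openin_subtopology by blast
  have o2: "x \<in> ?P \<inter> U" using xC star(1) W(3) by (simp add: y_def)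
  obtain N where N: "openin ?X N" "x \<in> N" and small: "\<forall>a\<in>N. \<forall>b\<in>N. k (a, b) \<subseteq> ?P \<inter> U"
    by (rule segment_small[OF csU o1 o2])
  \<comment> \<open>The new end of each arm: close enough to \<open>x\<close> for the shortened arm
    to map into \<open>W\<close>, and different from \<open>x\<close>.\<close>
  have "\<exists>w. w \<in> k (x, z) \<and> w \<in> N \<and> w \<noteq> x" if z: "z \<in> E" for z
  proof -
    have "infinite (k (x, z) \<inter> N)"
      using segment_not_isolated[OF csU, unfolded tX, OF star(1) _ _ N] z star(2) by blast
    then have "\<not> k (x, z) \<inter> N \<subseteq> {x}" using finite_subset by blast
    then show ?thesis by blast
  qed
  then obtain w where w: "\<And>z. z \<in> E \<Longrightarrow> w z \<in> k (x, z)" "\<And>z. z \<in> E \<Longrightarrow> w z \<in> N"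
      "\<And>z. z \<in> E \<Longrightarrow> w z \<noteq> x" by metis
  have EU: "z \<in> U" if "z \<in> E" for z using star(2) that by blast
  note segU = segment_basic[OF csU, unfolded tX]
  have wU: "w z \<in> U" if "z \<in> E" for z using w(1)[OF that] segU(4)[OF star(1) EU[OF that]] by blast
  have ksub: "k (x, w z) \<subseteq> k (x, z)" if z: "z \<in> E" for z
    using segment_mono[OF csU, unfolded tX, OF star(1) EU[OF z] segU(2)[OF star(1) EU[OF z]] w(1)[OF z]] .
  have kP: "k (x, w z) \<subseteq> ?P \<inter> U" if z: "z \<in> E" for z using small N(2) w(2)[OF z] by blast
  have ewW: "e (w z) \<in> W" if z: "z \<in> E" for z
    using kP[OF z] segU(3)[OF star(1) wU[OF z]] by blast
  have hk: "h (y, e (w z)) = e ` k (x, w z)" if z: "z \<in> E" for z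
    using ek[OF star(1) wU[OF z]] ewW[OF z] W(3) by (simp add: h_def y_def)
  have inj: "inj_on (\<lambda>z. e (w z)) E"
  proof (rule inj_onI, rule ccontr)
    fix z z' assume z: "z \<in> E" "z' \<in> E" "e (w z) = e (w z')" "z \<noteq> z'"
    then have "w z = w z'" using injU wU by blast
    then have "w z \<in> k (x, z) \<inter> k (x, z')" using w(1)[OF z(1)] w(1)[OF z(2)] by simp
    then show False using disj[OF z(1,2,4)] w(3)[OF z(1)] by blast
  qed
  let ?E = "(\<lambda>z. e (w z)) ` E"
  have "is_star ?Z h y ?E \<and> closedin ?Z (star_set h y ?E)"
    unfolding closed_star_iff[OF csW] tZ
  proof (intro conjI allI impI)
    show "y \<in> W" using W(3) .
    have "e (w z) \<noteq> y" if "z \<in> E" for z using injU[OF _ wU[OF that] star(1)] w(3)[OF that] by (auto simp: y_def)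
    then show "?E \<subseteq> W - {y}" using ewW by blast
    have "h (y, e (w z)) \<inter> h (y, e (w z')) = {y}" if z: "z \<in> E" "z' \<in> E" "z \<noteq> z'" for z z'
    proof
      show "h (y, e (w z)) \<inter> h (y, e (w z')) \<subseteq> {y}"
      proof
        fix p assume "p \<in> h (y, e (w z)) \<inter> h (y, e (w z'))"
        then obtain a b where ab: "a \<in> k (x, w z)" "b \<in> k (x, w z')" "p = e a" "p = e b"
          unfolding hk[OF z(1)] hk[OF z(2)] by blast
        then have "a = b" using injU[of a b] kP[OF z(1)] kP[OF z(2)] by blast
        then have "a \<in> k (x, z) \<inter> k (x, z')" using ab ksub[OF z(1)] ksub[OF z(2)] by blast
        then show "p \<in> {y}" using disj[OF z] ab(3) by (simp add: y_def)
      qed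
      show "{y} \<subseteq> h (y, e (w z)) \<inter> h (y, e (w z'))"
        using chart_segment(2)[OF lcs hW W(3)] ewW z by blast
    qed
    then show "\<forall>a\<in>?E. \<forall>b\<in>?E. a \<noteq> b \<longrightarrow> h (y, a) \<inter> h (y, b) = {y}" by auto
    fix A assume A: "A \<subseteq> star_set h y ?E \<and> (\<forall>a\<in>?E. closedin ?Z (A \<inter> h (y, a)))"
    have AE: "\<exists>z\<in>E. p \<in> e ` k (x, w z)" if "p \<in> A" for p
    proof -
      have "p \<in> star_set h y ?E" using A that by blast
      then obtain z where "z \<in> E" "p \<in> h (y, e (w z))" unfolding star_set_def by blast
      then show ?thesis using hk by blast
    qed
    define B where "B = {t \<in> U. e t \<in> A}"
    have BE: "\<exists>z\<in>E. t \<in> k (x, w z)" if t: "t \<in> B" for t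
    proof -
      obtain z where z: "z \<in> E" "e t \<in> e ` k (x, w z)" using AE t unfolding B_def by blast
      then obtain t' where t': "t' \<in> k (x, w z)" "e t = e t'" by blast
      then have "t = t'" using injU[of t t'] kP[OF z(1)] t unfolding B_def by blast
      then show ?thesis using z(1) t'(1) by blast
    qed
    have "closedin ?X B"
    proof (rule fine)
      show "B \<subseteq> star_set k x E" using BE ksub unfolding star_set_def by blast
      fix z assume z: "z \<in> E"
      let ?H = "h (y, e (w z))"
      \<comment> \<open>Compactness of the arm turns closedness in \<open>W\<close> into closedness
        in all of \<open>Y\<close>, which can then be pulled back along \<open>e\<close>.\<close>
      have comp: "compactin ?Z ?H"
        using compactin_segment[OF csW, unfolded tZ, OF W(3) ewW[OF z]] .
      have "closedin ?Z (A \<inter> ?H)" using A z by blast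
      then have "compactin ?Z (A \<inter> ?H)" by (rule closed_compactin[OF comp Int_lower2])
      then have "compactin Y (A \<inter> ?H)" by (simp add: compactin_subtopology)
      then have "closedin Y (A \<inter> ?H)" by (rule compactin_imp_closedin[OF YH])
      then have "closedin C {t \<in> topspace C. e t \<in> A \<inter> ?H}"
        by (rule closedin_continuous_map_preimage[OF cont])
      then have "closedin ?X ({t \<in> topspace C. e t \<in> A \<inter> ?H} \<inter> U)"
        unfolding closedin_subtopology by blast
      moreover have "{t \<in> topspace C. e t \<in> A \<inter> ?H} \<inter> U = B \<inter> k (x, z)"
      proof (rule subset_antisym; rule subsetI)
        fix t assume t: "t \<in> {t \<in> topspace C. e t \<in> A \<inter> ?H} \<inter> U"
        then have "e t \<in> e ` k (x, w z)" using hk[OF z] by simp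
        then obtain t' where t': "t' \<in> k (x, w z)" "e t = e t'" by blast
        then have "t = t'" using injU[of t t'] kP[OF z] t by blast
        then show "t \<in> B \<inter> k (x, z)" using t t'(1) ksub[OF z] unfolding B_def by blast
      next
        fix t assume t: "t \<in> B \<inter> k (x, z)"
        then obtain z' where z': "z' \<in> E" "t \<in> k (x, w z')" using BE by blast
        \<comment> \<open>A point of \<open>B\<close> on the long arm to \<open>z\<close> lies on
          some shortened arm. If that arm belongs to another end, the point is the centre
          \<open>x\<close>, which is on every shortened arm.\<close>
        have "t \<in> k (x, w z)"
        proof (cases "z' = z")
          case False
          have "t \<in> k (x, z) \<inter> k (x, z')" using t z'(2) ksub[OF z'(1)] by blast
          then have "t = x" using disj[OF z z'(1)] False by blast
          then show ?thesis using segU(2)[OF star(1) wU[OF z]] by simp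
        qed (use z' in simp)
        then show "t \<in> {t \<in> topspace C. e t \<in> A \<inter> ?H} \<inter> U"
          using t hk[OF z] kP[OF z] by (auto simp: B_def)
      qed
      ultimately show "closedin ?X (B \<inter> k (x, z))" by simp
    qed
    then have "closedin (subtopology Y (e ` U)) (e ` B)"
      using homeomorphic_map_closedness[OF sheetD(2)[OF U(1)], of B] unfolding tX B_def by blast
    moreover have "e ` B = A"
    proof
      show "A \<subseteq> e ` B"
      proof
        fix p assume p: "p \<in> A"
        then obtain z t where "z \<in> E" "t \<in> k (x, w z)" "p = e t" using AE by blast
        then show "p \<in> e ` B" using p kP[of z] unfolding B_def by blast
      qed
    qed (auto simp: B_def)
    moreover have "A \<subseteq> W"
    proof
      fix p assume "p \<in> A"
      then obtain z t where "z \<in> E" "t \<in> k (x, w z)" "p = e t" using AE by blast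
      then show "p \<in> W" using kP[of z] by blast
    qed
    ultimately show "closedin ?Z A" using closed_in_sheet by simp
  qed
  then have "finite ?E" using sf[OF hW] unfolding star_finite_def by blast
  then show "finite E" using inj by (rule finite_imageD)
qed

section \<open>Verification of the axioms for \<open>C\<close>\<close>

theorem theorem2:
  fixes C :: "'c topology" and Y :: "'a topology" and \<V> :: "'a atlas" and e :: "'c \<Rightarrow> 'a"
  assumes "geodesic_q_manifold Y \<V>"
    and "etale_map C Y \<V> e"
  shows "geodesic_q_manifold C (induced_atlas C Y \<V> e)"
proof -
  let ?A = "induced_atlas C Y \<V> e"
  have Y: "geodesic_manifold Y \<V>" and reg: "\<And>V K. (V, K) \<in> \<V> \<Longrightarrow> regular_space (subtopology Y V)"
    using assms(1) by (auto simp: geodesic_q_manifold_def)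
  have lcs: "local_convexity_structure Y \<V>" and YH: "Hausdorff_space Y"
    using Y by (simp_all add: geodesic_manifold_def)
  have cont: "continuous_map C Y e" and CH: "Hausdorff_space C" and closed: "closed_map C Y e"
    using assms(2) by (simp_all add: etale_map_def)
  have "proper_map C Y e"
    unfolding proper_map_def
  proof (intro conjI ballI)
    fix y assume "y \<in> topspace Y"
    show "compactin C {x \<in> topspace C. e x = y}"
      using etale_finite_fibre[OF assms] by (intro finite_imp_compactin) auto
  qed (rule closed)
  have hulls: "compactin C (C closure_of local_convex_hull C ?A F)" if F: "finite F" "F \<subseteq> topspace C" for F
  proof -
    have eF: "finite (e ` F)" "e ` F \<subseteq> topspace Y"
      using F continuous_map_image_subset_topspace[OF cont] by auto
    let ?H = "local_convex_hull Y \<V> (e ` F)"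
    let ?P = "{c \<in> topspace C. e c \<in> Y closure_of ?H}"
    have HY: "?H \<subseteq> topspace Y" "locally_convex_subset Y \<V> ?H"
      using locally_convex_subset_hull[OF lcs eF(2)] by (simp_all add: locally_convex_subset_def)
    have "compactin Y (Y closure_of ?H)" using Y eF by (simp add: geodesic_manifold_def)
    then have comp: "compactin C ?P" by (rule compactin_proper_map_preimage[OF \<open>proper_map C Y e\<close>])
    have "local_convex_hull C ?A F \<subseteq> {c \<in> topspace C. e c \<in> ?H}"
      unfolding local_convex_hull_def[of C]
    proof (rule hull_minimal)
      show "F \<subseteq> {c \<in> topspace C. e c \<in> ?H}"
        using F(2) hull_subset[of "e ` F"] unfolding local_convex_hull_def by blast
      show "locally_convex_subset C ?A {c \<in> topspace C. e c \<in> ?H}"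
        by (rule locally_convex_subset_preimage[OF lcs assms(2) HY(2)])
    qed
    also have "\<dots> \<subseteq> ?P" using closure_of_subset[OF HY(1)] by blast
    finally have "C closure_of local_convex_hull C ?A F \<subseteq> ?P"
      using compactin_imp_closedin[OF CH comp] by (rule closure_of_minimal)
    then show ?thesis using closedin_closure_of by (rule closed_compactin[OF comp])
  qed
  \<comment> \<open>The points of \<open>D\<close> have type \<open>'c \<times> nat\<close>, while
    (G2) for \<open>Y\<close> is stated over \<open>'a \<times> nat\<close>; hence the version of
    (G2) for all types is applied to \<open>e \<circ> g\<close>.\<close>
  have minimal: "A = topspace D"
    if g: "etale_map D C ?A g \<and> compact_space D \<and> etale_generated_by D C ?A g {x, y}"
      and A: "connectedin D A \<and> x \<in> A \<and> y \<in> A" for D :: "('c \<times> nat) topology" and g x y A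
    using geodesic_manifold_etale_minimal[OF Y etale_map_trans[OF lcs assms(2), of D g], of x y A]
      etale_generated_by_trans[OF lcs assms(2), of D g "{x, y}"] g A by blast
  have "geodesic_manifold C ?A"
    unfolding geodesic_manifold_def
  proof (intro conjI allI impI)
    show "Hausdorff_space C" by (rule CH)
    show "local_convexity_structure C ?A"
      by (rule local_convexity_structure_induced_atlas[OF lcs assms(2)])
  qed (erule conjE, rule hulls, assumption+, rule minimal, assumption+)
  moreover have "star_finite (subtopology C U) k \<and> regular_space (subtopology C U)"
    if Uk: "(U, k) \<in> ?A" for U k
  proof
    show "star_finite (subtopology C U) k" using etale_star_finite[OF assms Uk] .
    obtain V K where V: "(V, K) \<in> \<V>" and U: "sheet C Y e U" "convex_subset V K (e ` U)"
      using Uk unfolding induced_atlas_iff by blast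
    have "V \<inter> e ` U = e ` U" using convex_subsetD(1)[OF U(2)] by blast
    then have "regular_space (subtopology Y (e ` U))"
      using regular_space_subtopology[OF reg[OF V], of "e ` U"] by (simp only: subtopology_subtopology)
    then show "regular_space (subtopology C U)"
      using homeomorphic_regular_space[OF homeomorphic_map_imp_homeomorphic_space[OF sheetD(2)[OF U(1)]]]
      by simp
  qed
  ultimately show ?thesis unfolding geodesic_q_manifold_def by blast
qed

end
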